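(* Let $1<\ell<m$ be integers, let $k$ be an integer with $1\le k\le m$, and let $K=K(\{D_i\}_{i\ge1})\subset[0,1]^2$ be a Bedford-McMullen set with uniform fibers, where each pattern $D_i\subset\{1,\dots,m\}\times\{1,\dots,\ell\}$ has exactly $k$ elements in each row. Then $K$ is minimal for conformal dimension; thus $$\dim_C K=\dim_H K=1+\log_m k.$$
   Context: Bedford-McMullen sets: let $1<\ell<m$ be integers and let $D_1,D_2,\dots$ be subsets (patterns) of $\{1,\dots,m\}\times\{1,\dots,\ell\}$. Divide $[0,1]^2$ into $m\times\ell$ congruent closed rectangles of width $1/m$ and height $1/\ell$ with disjoint interiors ($m$ columns and $\ell$ rows); keep those corresponding to $D_1$ and remove the rest; let $K_1$ be the union of the kept ones. Inductively, $K_n$ is a union of closed rectangles of width $m^{-n}$ and height $\ell^{-n}$; divide each of them into $m\times\ell$ congruent closed rectangles of width $m^{-(n+1)}$ and height $\ell^{-(n+1)}$ with disjoint interiors and keep those corresponding to $D_{n+1}$; $K_{n+1}$ is the union of the kept rectangles. Set $K(\{D_i\})=\bigcap_n K_n$. The set has uniform fibers if there is an integer $k$ between $1$ and $m$ such that, for all $i\ge1$, $D_i$ has exactly $k$ elements in each row, i.e. for each $b\in\{1,\dots,\ell\}$ there are exactly $k$ values $a$ with $(a,b)\in D_i$. The metric on $K$ is Euclidean. $\dim_H$ denotes Hausdorff dimension. A homeomorphism $f:X\to Y$ between metric spaces is quasisymmetric if there is a homeomorphism $\eta:[0,\infty)\to[0,\infty)$ such that $d_Y(f(x),f(y))/d_Y(f(x),f(z))\le\eta\big(d_X(x,y)/d_X(x,z)\big)$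 for all $x,y,z\in X$ with $x\neq z$. The conformal dimension is $\dim_C X=\inf\{\dim_H f(X)\}$ over all quasisymmetric homeomorphisms $f$ of $X$ onto metric spaces. $X$ is minimal for conformal dimension if $\dim_C X=\dim_H X$. *)

theory Defs
  imports "HOL-Analysis.Analysis"
begin

section \<open>Hausdorff dimension of a metric space\<close>

text \<open>
  The diameter is extended-valued, so unbounded sets have diameter \<open>\<infinity>\<close>; the empty set has
  diameter \<open>0\<close>.
\<close>

definition ediam :: "'a metric \<Rightarrow> 'a set \<Rightarrow> ennreal" where
  "ediam X U = (SUP x\<in>U. SUP y\<in>U. ennreal (mdist X x y))"

text \<open>
  Finite covers are included, because members of a cover may be empty. Both quantities below are
  only used for exponents \<open>s > 0\<close>, where \<open>0 powr s = 0\<close> is the intended value; all diameters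
  occurring in a \<open>\<delta>\<close>-cover are finite, so \<^const>\<open>enn2real\<close> loses nothing.
\<close>

definition delta_covers :: "'a metric \<Rightarrow> real \<Rightarrow> (nat \<Rightarrow> 'a set) set" where
  "delta_covers X \<delta> =
     {U. (\<forall>i. U i \<subseteq> mspace X \<and> ediam X (U i) \<le> ennreal \<delta>) \<and> mspace X \<subseteq> (\<Union>i. U i)}"

definition hausdorff_premeasure :: "'a metric \<Rightarrow> real \<Rightarrow> real \<Rightarrow> ennreal" where
  "hausdorff_premeasure X s \<delta> =
     (INF U\<in>delta_covers X \<delta>. \<Sum>i. ennreal (enn2real (ediam X (U i)) powr s))"

definition hausdorff_measure :: "'a metric \<Rightarrow> real \<Rightarrow> ennreal" where
  "hausdorff_measure X s = (SUP \<delta>\<in>{0<..}. hausdorff_premeasure X s \<delta>)"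

text \<open>\<open>Inf {} = \<infinity>\<close> in \<^typ>\<open>ennreal\<close>, so spaces of infinite dimension get the value \<open>\<infinity>\<close>.\<close>

definition hausdorff_dim :: "'a metric \<Rightarrow> ennreal" where
  "hausdorff_dim X = Inf {ennreal s | s. 0 < s \<and> hausdorff_measure X s = 0}"


section \<open>Quasisymmetric maps and conformal dimension\<close>

definition quasisymmetric :: "'a metric \<Rightarrow> 'b metric \<Rightarrow> ('a \<Rightarrow> 'b) \<Rightarrow> bool" where
  "quasisymmetric X Y f \<longleftrightarrow>
     homeomorphic_map (mtopology_of X) (mtopology_of Y) f \<and>
     (\<exists>(\<eta>::real \<Rightarrow> real) \<theta>. homeomorphism {0..} {0..} \<eta> \<theta> \<and>
        (\<forall>x\<in>mspace X. \<forall>y\<in>mspace X. \<forall>z\<in>mspace X. x \<noteq> z \<longrightarrow>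
           mdist Y (f x) (f y) / mdist Y (f x) (f z) \<le> \<eta> (mdist X x y / mdist X x z)))"

text \<open>
  The infimum runs over the target spaces \<open>Y = f(X)\<close> whose points have the same type as those of
  \<open>X\<close>. This is no restriction: a homeomorphic image of \<open>X\<close> is isometric to a metric on the set
  \<open>X\<close> itself. See \<open>conformal_dim_le\<close>, where the target lives in an arbitrary type.
\<close>

definition conformal_dim :: "'a metric \<Rightarrow> ennreal" where
  "conformal_dim X = Inf {hausdorff_dim Y | (Y::'a metric) f. quasisymmetric X Y f}"

definition minimal_for_conformal_dim :: "'a metric \<Rightarrow> bool" where
  "minimal_for_conformal_dim X \<longleftrightarrow> conformal_dim X = hausdorff_dim X"

lemma conformal_dim_le:
  fixes X :: "'a metric" and Y :: "'b metric"
  assumes qs: "quasisymmetric X Y f"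
  shows "conformal_dim X \<le> hausdorff_dim Y"
proof -
  have hom: "homeomorphic_map (mtopology_of X) (mtopology_of Y) f"
    using qs by (simp add: quasisymmetric_def)
  have inj: "inj_on f (mspace X)" and im: "f ` mspace X = mspace Y"
    using homeomorphic_imp_injective_map[OF hom] homeomorphic_imp_surjective_map[OF hom] by simp_all
  have fin: "f x \<in> mspace Y" if "x \<in> mspace X" for x
    using im that by blast
  define d where "d = (\<lambda>x y. mdist Y (f x) (f y))"
  have ms: "Metric_space (mspace X) d"
  proof
    show "d x z \<le> d x y + d y z"
      if "x \<in> mspace X" "y \<in> mspace X" "z \<in> mspace X" for x y z
      using that by (simp add: d_def fin mdist_triangle)
    show "(d x y = 0) \<longleftrightarrow> x = y" if "x \<in> mspace X" "y \<in> mspace X" for x y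
      using that by (simp add: d_def fin inj_on_eq_iff[OF inj])
  qed (auto simp: d_def mdist_commute)
  define Z where "Z = metric (mspace X, d)"
  have Z[simp]: "mspace Z = mspace X" "mdist Z = d"
    using ms by (simp_all add: Z_def Metric_space.mspace_metric Metric_space.mdist_metric)
  have homZ: "homeomorphic_map (mtopology_of Z) (mtopology_of Y) f"
    unfolding mtopology_of_def
    by (rule Metric_space12.isometry_imp_homeomorphic_map[OF Metric_space12_mspace_mdist])
       (simp_all add: im d_def)
  have "homeomorphic_map (mtopology_of X) (mtopology_of Z) id"
  proof -
    obtain g where g: "homeomorphic_maps (mtopology_of Z) (mtopology_of Y) f g"
      using homZ homeomorphic_map_maps by blast
    then have "homeomorphic_map (mtopology_of Y) (mtopology_of Z) g"
      using homeomorphic_maps_map by blast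
    with hom have "homeomorphic_map (mtopology_of X) (mtopology_of Z) (g \<circ> f)"
      using homeomorphic_map_compose by blast
    moreover have "(g \<circ> f) x = id x" if "x \<in> topspace (mtopology_of X)" for x
      using g that by (auto simp: homeomorphic_maps_def)
    ultimately show ?thesis
      using homeomorphic_map_eq by blast
  qed
  then have "quasisymmetric X Z id"
    using qs by (simp add: quasisymmetric_def d_def)
  then have "conformal_dim X \<le> hausdorff_dim Z"
    unfolding conformal_dim_def by (intro Inf_lower) blast
  also have "\<dots> \<le> hausdorff_dim Y"
  proof -
    have "hausdorff_premeasure Z s \<delta> \<le> hausdorff_premeasure Y s \<delta>" for s \<delta>
      unfolding hausdorff_premeasure_def
    proof (rule INF_mono)
      fix U assume U: "U \<in> delta_covers Y \<delta>"
      define V where "V = (\<lambda>i. {x \<in> mspace X. f x \<in> U i})"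
      have fV: "f ` V i = U i" for i
      proof -
        have "U i \<subseteq> f ` mspace X"
          using U im by (simp add: delta_covers_def)
        then show ?thesis
          by (auto simp: V_def)
      qed
      have diam: "ediam Z (V i) = ediam Y (U i)" for i
        unfolding ediam_def fV[symmetric] by (simp add: d_def image_image)
      have "V \<in> delta_covers Z \<delta>"
      proof -
        have "mspace X \<subseteq> (\<Union>i. V i)"
        proof
          fix x assume "x \<in> mspace X"
          moreover from this have "f x \<in> (\<Union>i. U i)"
            using U fin[of x] unfolding delta_covers_def by blast
          ultimately show "x \<in> (\<Union>i. V i)"
            by (auto simp: V_def)
        qed
        moreover have "V i \<subseteq> mspace X" for i
          by (auto simp: V_def)
        ultimately show ?thesis
          using U by (simp add: delta_covers_def diam)
      qed
      with diam show "\<exists>V\<in>delta_covers Z \<delta>.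
          (\<Sum>i. ennreal (enn2real (ediam Z (V i)) powr s))
          \<le> (\<Sum>i. ennreal (enn2real (ediam Y (U i)) powr s))"
        by (intro bexI[of _ V]) auto
    qed
    then have "hausdorff_measure Z s \<le> hausdorff_measure Y s" for s
      unfolding hausdorff_measure_def by (intro SUP_mono) blast
    then have "hausdorff_measure Z s = 0" if "hausdorff_measure Y s = 0" for s
      using that by (metis le_zero_eq)
    then show ?thesis
      unfolding hausdorff_dim_def by (intro Inf_superset_mono) blast
  qed
  finally show ?thesis .
qed


section \<open>Bedford-McMullen sets\<close>

text \<open>
  The unit square has \<open>m\<close> columns and \<open>l\<close> rows; the pair \<open>(a, b)\<close> denotes column \<open>a\<close> (counted
  from the left) and row \<open>b\<close> (counted from the bottom), both starting from \<open>1\<close>. The pattern used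
  to pass from step \<open>n\<close> to step \<open>n + 1\<close> is \<open>D (Suc n)\<close>; \<open>D 0\<close> is never used.

  A kept rectangle of step \<open>n\<close> is represented by its lower left corner.
\<close>

primrec bm_corners :: "nat \<Rightarrow> nat \<Rightarrow> (nat \<Rightarrow> (nat \<times> nat) set) \<Rightarrow> nat \<Rightarrow> (real \<times> real) set" where
  "bm_corners m l D 0 = {(0, 0)}"
| "bm_corners m l D (Suc n) =
     {(x + (real a - 1) / real m ^ Suc n, y + (real b - 1) / real l ^ Suc n) | x y a b.
        (x, y) \<in> bm_corners m l D n \<and> (a, b) \<in> D (Suc n)}"

definition bm_step :: "nat \<Rightarrow> nat \<Rightarrow> (nat \<Rightarrow> (nat \<times> nat) set) \<Rightarrow> nat \<Rightarrow> (real \<times> real) set" where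
  "bm_step m l D n =
     (\<Union>(x, y)\<in>bm_corners m l D n. {x..x + 1 / real m ^ n} \<times> {y..y + 1 / real l ^ n})"

definition bm_set :: "nat \<Rightarrow> nat \<Rightarrow> (nat \<Rightarrow> (nat \<times> nat) set) \<Rightarrow> (real \<times> real) set" where
  "bm_set m l D = (\<Inter>n\<in>{1..}. bm_step m l D n)"

definition bm_patterns :: "nat \<Rightarrow> nat \<Rightarrow> (nat \<Rightarrow> (nat \<times> nat) set) \<Rightarrow> bool" where
  "bm_patterns m l D \<longleftrightarrow> (\<forall>i\<ge>1. D i \<subseteq> {1..m} \<times> {1..l})"

definition uniform_fibers :: "nat \<Rightarrow> nat \<Rightarrow> (nat \<Rightarrow> (nat \<times> nat) set) \<Rightarrow> bool" where
  "uniform_fibers l k D \<longleftrightarrow> (\<forall>i\<ge>1. \<forall>b\<in>{1..l}. card {a. (a, b) \<in> D i} = k)"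

text \<open>The product metric of \<^typ>\<open>real \<times> real\<close> is the Euclidean one.\<close>

definition bm_space :: "nat \<Rightarrow> nat \<Rightarrow> (nat \<Rightarrow> (nat \<times> nat) set) \<Rightarrow> (real \<times> real) metric" where
  "bm_space m l D = submetric euclidean_metric (bm_set m l D)"

end

theory Submission
  imports Defs
begin

text \<open>
  At scale \<open>m\<^sup>-\<^sup>n\<close> the set \<open>K\<close> is resolved by approximate squares: a rectangle of step \<open>n\<close>, of
  width \<open>m\<^sup>-\<^sup>n\<close> and height \<open>l\<^sup>-\<^sup>n\<close>, is cut into rows of height \<open>l\<^sup>-\<^sup>N \<approx> m\<^sup>-\<^sup>n\<close>, where \<open>N = height n \<ge> n\<close>.
  With uniform fibers, \<open>K\<close> is parametrized by a product of two digit spaces: a sequence \<open>b\<close> of rows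
  and a sequence \<open>c\<close> of choices, \<open>c i\<close> telling which of the \<open>k\<close> columns available in row \<open>b i\<close> is
  used. Approximate squares are then pairs of words (\<open>n\<close> choices and \<open>height n\<close> rows), there are
  \<open>k\<^sup>n l\<^sup>N \<approx> m\<^sup>n\<^sup>Q\<close> of them with \<open>Q = 1 + log m k\<close>, and counting them gives \<open>dim\<^sub>H K \<le> Q\<close>
  (\<open>hausdorff_dim_bm_space_le\<close>).

  For the lower bound let \<open>f\<close> be quasisymmetric on \<open>K\<close>. Fixing \<open>c\<close> and letting \<open>b\<close> vary gives a
  vertical curve in \<open>K\<close>, possibly disconnected. Its piece over a row interval of length \<open>l\<^sup>-\<^sup>j\<close>
  consists of \<open>l\<close> stacked pieces of level \<open>j + 1\<close>, and consecutive ones are separated by at most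
  \<open>m\<^sup>-\<^sup>j\<close>, which is negligible against \<open>l\<^sup>-\<^sup>j\<close>. Quasisymmetry carries this over to the images, so the
  distance \<open>end_dist c w\<close> between the images of the two ends of a piece is at most \<open>1 + o(1)\<close> times
  the sum over its children (\<open>end_dist_le_children\<close>). Since it also decays exponentially in the
  level, every \<open>t < 1\<close> admits a positive lower bound, uniform in \<open>c\<close>, for the sum of
  \<open>end_dist c w powr t\<close> over any cut set of the tree of row words (\<open>curve_sum_lower_bound\<close>).

  Averaging over \<open>c\<close>, an approximate square \<open>v\<close> of level \<open>n\<close> is met by a fraction \<open>k\<^sup>-\<^sup>n\<close> of the
  curves, so \<open>\<Sum>\<^sub>v k\<^sup>-\<^sup>n diam(f v)\<^sup>t\<close> is bounded below over every finite covering by approximate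
  squares (\<open>covering_average_lower_bound\<close>). For an antichain the masses \<open>k\<^sup>-\<^sup>n l\<^sup>-\<^sup>N\<close> add up to at most
  \<open>1\<close>, and a Hoelder-type inequality with exponent \<open>Q\<close> turns this into a lower bound for
  \<open>\<Sum>\<^sub>v diam(f v)\<^bsup>tQ\<^esup>\<close> (\<open>covering_sum_lower_bound\<close>). Finally, every subset of the image is covered by
  boundedly many images of approximate squares, of size at most a constant times its diameter plus
  an arbitrarily small error (\<open>cover_set_by_nodes\<close>), and compactness of the digit spaces reduces countable coverings to
  finite ones. Hence \<open>dim\<^sub>H f(K) \<ge> Q\<close> for every quasisymmetric \<open>f\<close>.
\<close>

section \<open>Digit sequences and their expansions\<close>

text \<open>
  Digits in base \<open>q\<close> run from \<open>0\<close> to \<open>q - 1\<close>; a word is a finite string of digits.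
\<close>

definition digit_seqs :: "nat \<Rightarrow> (nat \<Rightarrow> nat) set" where
  "digit_seqs q = {a. \<forall>i. a i < q}"

definition words :: "nat \<Rightarrow> nat \<Rightarrow> nat list set" where
  "words q n = {xs. set xs \<subseteq> {..<q} \<and> length xs = n}"

definition prefix :: "(nat \<Rightarrow> nat) \<Rightarrow> nat \<Rightarrow> nat list" where
  "prefix a n = map a [0..<n]"

text \<open>The infinite continuation of a word by the constant digit \<open>e\<close>.\<close>

definition fill :: "nat \<Rightarrow> nat list \<Rightarrow> nat \<Rightarrow> nat" where
  "fill e xs i = (if i < length xs then xs ! i else e)"

text \<open>
  The real number with digits \<open>a 0, a 1, ...\<close> after the point in base \<open>q\<close>, and the integer whose
  digits, most significant first, are \<open>a 0, ..., a (n - 1)\<close>.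
\<close>

definition expansion :: "nat \<Rightarrow> (nat \<Rightarrow> nat) \<Rightarrow> real" where
  "expansion q a = (\<Sum>i. real (a i) / real q ^ Suc i)"

primrec horner :: "nat \<Rightarrow> (nat \<Rightarrow> nat) \<Rightarrow> nat \<Rightarrow> nat" where
  "horner q a 0 = 0"
| "horner q a (Suc n) = q * horner q a n + a n"

lemma length_prefix [simp]: "length (prefix a n) = n"
  by (simp add: prefix_def)

lemma prefix_eq_iff: "prefix a n = prefix b n \<longleftrightarrow> (\<forall>i<n. a i = b i)"
  by (auto simp: prefix_def)

lemma prefix_eq_list_iff: "prefix a n = xs \<longleftrightarrow> length xs = n \<and> (\<forall>i<n. a i = xs ! i)"
  by (auto simp: prefix_def list_eq_iff_nth_eq)

lemma take_prefix: "j \<le> n \<Longrightarrow> take j (prefix a n) = prefix a j"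
  by (auto simp: prefix_def list_eq_iff_nth_eq)

lemma prefix_fill: "n \<le> length xs \<Longrightarrow> prefix (fill e xs) n = take n xs"
  by (auto simp: prefix_def fill_def list_eq_iff_nth_eq)

lemma prefix_in_words: "a \<in> digit_seqs q \<Longrightarrow> prefix a n \<in> words q n"
  by (auto simp: prefix_def words_def digit_seqs_def)

lemma nth_words: "xs \<in> words q n \<Longrightarrow> i < n \<Longrightarrow> xs ! i < q"
  using subsetD[OF _ nth_mem, of xs "{..<q}" i] by (simp add: words_def)

lemma fill_in_digit_seqs: "xs \<in> words q n \<Longrightarrow> e < q \<Longrightarrow> fill e xs \<in> digit_seqs q"
  using nth_words[of xs q n] by (auto simp: fill_def digit_seqs_def words_def)

lemma snoc_in_words: "xs \<in> words q n \<Longrightarrow> d < q \<Longrightarrow> xs @ [d] \<in> words q (Suc n)"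
  by (auto simp: words_def)

lemma take_in_words: "xs \<in> words q n \<Longrightarrow> j \<le> n \<Longrightarrow> take j xs \<in> words q j"
  using set_take_subset[of j xs] by (auto simp: words_def)

lemma finite_words [simp]: "finite (words q n)"
  using finite_lists_length_eq[of "{..<q}" n] by (simp add: words_def)

lemma card_words: "card (words q n) = q ^ n"
  using card_lists_length_eq[of "{..<q}" n] by (simp add: words_def)

lemma card_words_extending:
  assumes "xs \<in> words q j" "j \<le> n"
  shows "card {ys \<in> words q n. take j ys = xs} = q ^ (n - j)"
proof -
  have "{ys \<in> words q n. take j ys = xs} = (@) xs ` words q (n - j)"
  proof (intro equalityI subsetI)
    fix ys assume "ys \<in> {ys \<in> words q n. take j ys = xs}"
    then have "ys = xs @ drop j ys" "drop j ys \<in> words q (n - j)"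
      using set_drop_subset[of j ys] by (auto simp: words_def)
    then show "ys \<in> (@) xs ` words q (n - j)" by blast
  qed (use assms in \<open>auto simp: words_def\<close>)
  moreover have "inj_on ((@) xs) (words q (n - j))"
    by (simp add: inj_on_def)
  ultimately show ?thesis
    by (simp only: card_image card_words)
qed

lemma horner_eq: "0 < q \<Longrightarrow> real (horner q a n) / real q ^ n = (\<Sum>i<n. real (a i) / real q ^ Suc i)"
  by (induction n) (simp_all add: add_divide_distrib)

lemma horner_cong: "(\<And>i. i < n \<Longrightarrow> a i = b i) \<Longrightarrow> horner q a n = horner q b n"
  by (induction n) auto

lemma horner_inj:
  assumes "horner q a n = horner q b n" "\<And>i. i < n \<Longrightarrow> a i < q" "\<And>i. i < n \<Longrightarrow> b i < q"
  shows "\<forall>i<n. a i = b i"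
  using assms
proof (induction n)
  case (Suc n)
  have "a n < q" "b n < q" using Suc.prems by auto
  have eq: "q * horner q a n + a n = q * horner q b n + b n"
    using Suc.prems(1) by simp
  have "a n = b n"
    using arg_cong[OF eq, of "\<lambda>x. x mod q"] \<open>a n < q\<close> \<open>b n < q\<close> by simp
  moreover from this have "horner q a n = horner q b n"
    using eq \<open>a n < q\<close> by simp
  then have "\<forall>i<n. a i = b i"
    using Suc.IH Suc.prems by simp
  ultimately show ?case
    by (simp add: less_Suc_eq)
qed simp

text \<open>The \<open>q\<close>-adic intervals of a digit sequence are nested.\<close>

lemma horner_refine:
  assumes "n \<le> N" "0 < q" "\<And>i. i < N \<Longrightarrow> a i < q"
  shows "real (horner q a n) / real q ^ n \<le> real (horner q a N) / real q ^ N"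
    "(real (horner q a N) + 1) / real q ^ N \<le> (real (horner q a n) + 1) / real q ^ n"
proof -
  have "real (horner q a n) / real q ^ n \<le> real (horner q a N) / real q ^ N \<and>
    (real (horner q a N) + 1) / real q ^ N \<le> (real (horner q a n) + 1) / real q ^ n"
    using assms(1,3)
  proof (induction N rule: dec_induct)
    case (step N)
    have a: "real (a N) + 1 \<le> real q" using step.prems[of N] by simp
    have "real (horner q a N) / real q ^ N = real (q * horner q a N) / real q ^ Suc N"
      using assms(2) by simp
    also have "\<dots> \<le> real (horner q a (Suc N)) / real q ^ Suc N"
      by (intro divide_right_mono) auto
    finally have 1: "real (horner q a N) / real q ^ N \<le> real (horner q a (Suc N)) / real q ^ Suc N" .
    have "(real (horner q a (Suc N)) + 1) / real q ^ Suc N \<le> (real q * (real (horner q a N) + 1)) / real q ^ Suc N"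
      using a by (intro divide_right_mono) (auto simp: algebra_simps)
    also have "\<dots> = (real (horner q a N) + 1) / real q ^ N"
      using assms(2) by simp
    finally show ?case using 1 step by (meson less_SucI order_trans)
  qed auto
  then show "real (horner q a n) / real q ^ n \<le> real (horner q a N) / real q ^ N"
    "(real (horner q a N) + 1) / real q ^ N \<le> (real (horner q a n) + 1) / real q ^ n"
    by blast+
qed

lemma horner_Suc_div:
  "0 < q \<Longrightarrow> real (horner q a (Suc n)) / real q ^ Suc n =
    real (horner q a n) / real q ^ n + real (a n) / real q ^ Suc n"
  by (simp add: add_divide_distrib)

lemma max_digits_sums:
  assumes "2 \<le> q"
  shows "(\<lambda>i. real (q - 1) / real q ^ Suc (i + n)) sums (1 / real q ^ n)"
proof -
  have "(\<lambda>i. (1 / real q) ^ i) sums (1 / (1 - 1 / real q))"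
    by (rule geometric_sums) (use assms in auto)
  from sums_mult[OF this, of "real (q - 1) / real q ^ Suc n"]
  have "(\<lambda>i. real (q - 1) / real q ^ Suc n * (1 / real q) ^ i) sums
      (real (q - 1) / real q ^ Suc n * (1 / (1 - 1 / real q)))" .
  moreover have "real (q - 1) / real q ^ Suc n * (1 / (1 - 1 / real q)) = 1 / real q ^ n"
    using assms by (simp add: field_simps of_nat_diff)
  moreover have "real (q - 1) / real q ^ Suc n * (1 / real q) ^ i = real (q - 1) / real q ^ Suc (i + n)" for i
    by (simp add: power_add power_one_over)
  ultimately show ?thesis by simp
qed

text \<open>The remainder after \<open>n\<close> digits, extremal when all later digits are \<open>0\<close> or all are \<open>q - 1\<close>.\<close>

lemma expansion_tail:
  assumes "2 \<le> q" "a \<in> digit_seqs q"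
  obtains t where "expansion q a = real (horner q a n) / real q ^ n + t"
    "0 \<le> t" "t \<le> 1 / real q ^ n"
    "(\<forall>i\<ge>n. a i = 0) \<longrightarrow> t = 0" "(\<forall>i\<ge>n. a i = q - 1) \<longrightarrow> t = 1 / real q ^ n"
proof -
  have le: "real (a i) / real q ^ Suc i \<le> real (q - 1) / real q ^ Suc i" for i
  proof -
    have "a i \<le> q - 1" using assms(2) by (auto simp: digit_seqs_def dest: spec[of _ i])
    then show ?thesis by (intro divide_right_mono) auto
  qed
  have summ: "summable (\<lambda>i. real (a i) / real q ^ Suc i)"
  proof (rule summable_comparison_test')
    show "summable (\<lambda>i. real (q - 1) / real q ^ Suc i)"
      using sums_summable[OF max_digits_sums[OF assms(1), of 0]] by (simp only: add_0_right)
    show "norm (real (a i) / real q ^ Suc i) \<le> real (q - 1) / real q ^ Suc i" for i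
      using le[of i] by (simp only: real_norm_def) simp
  qed
  define t where "t = (\<Sum>i. real (a (i + n)) / real q ^ Suc (i + n))"
  have summ': "summable (\<lambda>i. real (a (i + n)) / real q ^ Suc (i + n))"
    using summ by (rule summable_ignore_initial_segment)
  have "expansion q a = real (horner q a n) / real q ^ n + t"
    unfolding expansion_def t_def using suminf_split_initial_segment[OF summ, of n] assms(1)
    by (simp add: horner_eq)
  moreover have "0 \<le> t"
    unfolding t_def by (intro suminf_nonneg summ') auto
  moreover have "t \<le> 1 / real q ^ n"
    unfolding t_def sums_unique[OF max_digits_sums[OF assms(1), of n]]
    by (intro suminf_le summ' le sums_summable[OF max_digits_sums[OF assms(1)]])
  moreover have "t = 0" if "\<forall>i\<ge>n. a i = 0"
    unfolding t_def using that by simp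
  moreover have "t = 1 / real q ^ n" if "\<forall>i\<ge>n. a i = q - 1"
    unfolding t_def sums_unique[OF max_digits_sums[OF assms(1), of n]] using that by simp
  ultimately show thesis using that by blast
qed

lemma expansion_bounds:
  assumes "2 \<le> q" "a \<in> digit_seqs q"
  shows "real (horner q a n) / real q ^ n \<le> expansion q a"
    "expansion q a \<le> real (horner q a n) / real q ^ n + 1 / real q ^ n"
  by (rule expansion_tail[OF assms, of n]; simp)+

lemma expansion_fill_0:
  assumes "2 \<le> q" "xs \<in> words q n"
  shows "expansion q (fill 0 xs) = real (horner q (fill 0 xs) n) / real q ^ n"
proof -
  have "fill 0 xs \<in> digit_seqs q" using assms by (intro fill_in_digit_seqs) auto
  then show ?thesis
    by (rule expansion_tail[OF assms(1), of _ n]) (use assms in \<open>auto simp: fill_def words_def\<close>)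
qed

lemma expansion_fill_max:
  assumes "2 \<le> q" "xs \<in> words q n"
  shows "expansion q (fill (q - 1) xs) = (real (horner q (fill 0 xs) n) + 1) / real q ^ n"
proof -
  have "fill (q - 1) xs \<in> digit_seqs q" using assms by (intro fill_in_digit_seqs) auto
  then have "expansion q (fill (q - 1) xs) = (real (horner q (fill (q - 1) xs) n) + 1) / real q ^ n"
    by (rule expansion_tail[OF assms(1), of _ n])
      (use assms in \<open>auto simp: fill_def words_def add_divide_distrib\<close>)
  moreover have "horner q (fill (q - 1) xs) n = horner q (fill 0 xs) n"
    using assms by (intro horner_cong) (auto simp: fill_def words_def)
  ultimately show ?thesis by simp
qed

lemma expansion_close:
  assumes "2 \<le> q" "a \<in> digit_seqs q" "b \<in> digit_seqs q" "\<And>i. i < n \<Longrightarrow> a i = b i"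
  shows "\<bar>expansion q a - expansion q b\<bar> \<le> 1 / real q ^ n"
  using expansion_bounds[OF assms(1,2), of n] expansion_bounds[OF assms(1,3), of n]
    horner_cong[of n a b q, OF assms(4)] by (simp add: abs_le_iff)

lemma compact_digit_seqs: "compact (digit_seqs q)"
proof -
  have "compactin (product_topology (\<lambda>i. euclidean) UNIV) (PiE UNIV (\<lambda>i::nat. {..<q}))"
    by (simp add: compactin_PiE finite_imp_compact)
  moreover have "PiE UNIV (\<lambda>i::nat. {..<q}) = digit_seqs q"
    by (auto simp: digit_seqs_def PiE_def Pi_def)
  ultimately show ?thesis
    by (simp add: euclidean_product_topology)
qed

lemma open_cylinder: "open {a. prefix a n = xs}"
proof -
  have "{a. prefix a n = xs} = (if length xs = n then {a. \<forall>i\<in>{..<n}. a i \<in> {xs ! i}} else {})"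
    by (auto simp: prefix_eq_list_iff)
  moreover have "open {a::nat\<Rightarrow>nat. \<forall>i\<in>{..<n}. a i \<in> {xs ! i}}"
    by (rule product_topology_basis'[where x = "\<lambda>i. i"]) (auto simp: open_discrete)
  ultimately show ?thesis by simp
qed

text \<open>
  A pair of words stands for the cylinder of all pairs of digit sequences that continue it; a set
  of such pairs is a covering if its cylinders cover the product of the two digit spaces.
\<close>

definition covering :: "nat \<Rightarrow> nat \<Rightarrow> (nat list \<times> nat list) set \<Rightarrow> bool" where
  "covering k l A \<longleftrightarrow> (\<forall>c\<in>digit_seqs k. \<forall>b\<in>digit_seqs l.
     \<exists>(xs, ys)\<in>A. prefix c (length xs) = xs \<and> prefix b (length ys) = ys)"

text \<open>Cylinders are open and the digit spaces are compact.\<close>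

lemma covering_finite_subset:
  assumes cover: "covering k l A"
  obtains F where "F \<subseteq> A" "finite F" "covering k l F"
proof -
  define Z where "Z = (\<lambda>(xs, ys). {c. prefix c (length xs) = xs} \<times> {b. prefix b (length ys) = ys})"
  have Z: "covering k l F \<longleftrightarrow> digit_seqs k \<times> digit_seqs l \<subseteq> (\<Union>v\<in>F. Z v)" for F
    by (fastforce simp: covering_def Z_def)
  have "compact (digit_seqs k \<times> digit_seqs l)"
    by (intro compact_Times compact_digit_seqs)
  moreover have "open (Z v)" if "v \<in> A" for v
    by (auto simp: Z_def split_beta intro!: open_Times open_cylinder)
  moreover have "digit_seqs k \<times> digit_seqs l \<subseteq> (\<Union>v\<in>A. Z v)"
    using cover by (simp only: Z)
  ultimately obtain F where "F \<subseteq> A" "finite F" "digit_seqs k \<times> digit_seqs l \<subseteq> (\<Union>v\<in>F. Z v)"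
    by (rule compactE_image)
  then show thesis
    by (intro that[of F]) (simp_all only: Z)
qed

section \<open>Elementary inequalities\<close>

lemma nats_near_real:
  fixes S :: "nat set"
  assumes "\<And>i. i \<in> S \<Longrightarrow> \<bar>real i - x\<bar> \<le> real r"
  shows "finite S \<and> card S \<le> 2 * r + 1"
proof (cases "S = {}")
  case False
  define i0 where "i0 = (LEAST i. i \<in> S)"
  have i0: "i0 \<in> S" "\<And>i. i \<in> S \<Longrightarrow> i0 \<le> i"
    using False unfolding i0_def by (auto intro: LeastI Least_le)
  have "S \<subseteq> {i0..i0 + 2 * r}"
  proof
    fix i assume "i \<in> S"
    then have "real i \<le> real i0 + 2 * real r"
      using assms[of i] assms[OF i0(1)] by (auto simp: abs_le_iff)
    then have "i \<le> i0 + 2 * r" by linarith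
    then show "i \<in> {i0..i0 + 2 * r}" using i0(2)[OF \<open>i \<in> S\<close>] by auto
  qed
  then show ?thesis
    using card_mono[of "{i0..i0 + 2 * r}" S] finite_subset[of S "{i0..i0 + 2 * r}"] by simp
qed auto

lemma dist_prod_le:
  fixes p q :: "real \<times> real"
  shows "dist p q \<le> \<bar>fst p - fst q\<bar> + \<bar>snd p - snd q\<bar>"
  by (metis dist_prod_def dist_real_def real_sqrt_abs2 sqrt_sum_squares_le_sum_abs power2_abs)

lemma sum_UN_le:
  fixes g :: "'a \<Rightarrow> real" and n :: nat
  assumes "\<And>i. finite (F i)" "\<And>v. 0 \<le> g v"
  shows "(\<Sum>v\<in>(\<Union>i<n. F i). g v) \<le> (\<Sum>i<n. \<Sum>v\<in>F i. g v)"
proof (induction n)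
  case (Suc n)
  let ?A = "\<Union>i<n. F i"
  have fin: "finite ?A" using assms by auto
  have eq: "(\<Union>i<Suc n. F i) = ?A \<union> F n" by (auto simp: less_Suc_eq)
  have "sum g (?A \<union> F n) + sum g (?A \<inter> F n) = sum g ?A + sum g (F n)"
    by (rule sum.union_inter[OF fin assms(1)])
  moreover have "0 \<le> sum g (?A \<inter> F n)" using assms by (intro sum_nonneg)
  ultimately show ?case unfolding eq using Suc by simp
qed simp

text \<open>A pointwise substitute for Hoelder's inequality; integrate it for a good choice of \<open>a\<close>.\<close>

lemma powr_tangent_bound:
  fixes x a q :: real
  assumes "0 \<le> x" "0 < a" "1 \<le> q"
  shows "x \<le> a + a powr (1 - q) * x powr q"
proof (cases "x \<le> a")
  case True
  then show ?thesis using assms by (simp add: add_increasing2)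
next
  case False
  have "a powr (q - 1) \<le> x powr (q - 1)"
    using False assms by (intro powr_mono2) auto
  then have "a powr (1 - q) * (a powr (q - 1) * x) \<le> a powr (1 - q) * (x powr (q - 1) * x)"
    using assms by (intro mult_left_mono mult_right_mono) auto
  moreover have "a powr (1 - q) * (a powr (q - 1) * x) = x"
    using assms by (simp add: mult.assoc[symmetric] flip: powr_add)
  moreover have "x powr (q - 1) * x = x powr q"
    using False assms by (simp add: powr_diff)
  ultimately show ?thesis using assms by simp
qed

section \<open>Cut sets in a regular tree\<close>

text \<open>
  If a nonnegative function on words is at most the sum of its values on the children of a word, then its value
  at the root is at most its sum over any finite set of words that every digit sequence meets.
\<close>

lemma tree_cut_sum:
  fixes g :: "nat list \<Rightarrow> real"
  assumes l: "0 < l" and B: "finite B" and nonneg: "\<And>w. w \<in> B \<Longrightarrow> 0 \<le> g w"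
    and step: "\<And>j w. w \<in> words l j \<Longrightarrow> g w \<le> (\<Sum>d<l. g (w @ [d]))"
    and cut: "\<And>b. b \<in> digit_seqs l \<Longrightarrow> \<exists>u\<in>B. prefix b (length u) = u"
  shows "g [] \<le> (\<Sum>w\<in>B. g w)"
proof -
  define M where "M = Max (insert 0 (length ` B))"
  have M: "length u \<le> M" if "u \<in> B" for u
    unfolding M_def using B that by (intro Max_ge) auto
  have "g w \<le> (\<Sum>u\<in>{u \<in> B. j \<le> length u \<and> take j u = w}. g u)"
    if "w \<in> words l j" "j + r = M"
      "\<And>b. b \<in> digit_seqs l \<Longrightarrow> prefix b j = w \<Longrightarrow> \<exists>u\<in>B. j \<le> length u \<and> prefix b (length u) = u"
    for r w j
    using that
  proof (induction r arbitrary: w j)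
    case (0 w j)
    have b: "fill 0 w \<in> digit_seqs l" "prefix (fill 0 w) j = w"
      using 0 l by (auto intro: fill_in_digit_seqs simp: prefix_fill words_def)
    obtain u where "u \<in> B" "j \<le> length u" "prefix (fill 0 w) (length u) = u"
      using "0.prems"(3)[OF b] by blast
    then have "w \<in> {u \<in> B. j \<le> length u \<and> take j u = w}"
      using M[of u] 0 b by auto
    then show ?case
      using B nonneg by (intro member_le_sum) auto
  next
    case (Suc r w j)
    have lw: "length w = j" using Suc.prems by (simp add: words_def)
    show ?case
    proof (cases "w \<in> B")
      case True
      then show ?thesis
        using B nonneg lw by (intro member_le_sum) auto
    next
      case False
      let ?S = "\<lambda>w j. {u \<in> B. j \<le> length u \<and> take j u = w}"
      have "g w \<le> (\<Sum>d<l. g (w @ [d]))"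
        using step Suc.prems by blast
      also have "\<dots> \<le> (\<Sum>d<l. \<Sum>u\<in>?S (w @ [d]) (Suc j). g u)"
      proof (intro sum_mono Suc.IH)
        fix d assume d: "d \<in> {..<l}"
        show "w @ [d] \<in> words l (Suc j)" using d Suc.prems by (simp add: snoc_in_words)
        show "Suc j + r = M" using Suc.prems by simp
        fix b assume b: "b \<in> digit_seqs l" "prefix b (Suc j) = w @ [d]"
        then have bw: "prefix b j = w"
          using lw take_prefix[of j "Suc j" b] by simp
        obtain u where u: "u \<in> B" "j \<le> length u" "prefix b (length u) = u"
          using Suc.prems(3)[OF b(1) bw] by blast
        then have "length u \<noteq> j" using bw False by auto
        then show "\<exists>u\<in>B. Suc j \<le> length u \<and> prefix b (length u) = u"
          using u by (intro bexI[of _ u]) auto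
      qed
      also have "\<dots> = (\<Sum>u\<in>(\<Union>d\<in>{..<l}. ?S (w @ [d]) (Suc j)). g u)"
        using B by (intro sum.UNION_disjoint[symmetric]) auto
      also have "\<dots> \<le> (\<Sum>u\<in>?S w j. g u)"
      proof (rule sum_mono2)
        show "(\<Union>d\<in>{..<l}. ?S (w @ [d]) (Suc j)) \<subseteq> ?S w j"
        proof
          fix u assume "u \<in> (\<Union>d\<in>{..<l}. ?S (w @ [d]) (Suc j))"
          then obtain d where "u \<in> B" "Suc j \<le> length u" "take (Suc j) u = w @ [d]" by auto
          moreover from this have "take j u = w"
            using lw by (metis append_eq_conv_conj min.absorb1 take_take Suc_n_not_le_n nat_le_linear)
          ultimately show "u \<in> ?S w j" by auto
        qed
      qed (use B nonneg in auto)
      finally show ?thesis .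
    qed
  qed
  from this[of "[]" 0 M] have "g [] \<le> (\<Sum>u\<in>{u \<in> B. 0 \<le> length u \<and> take 0 u = []}. g u)"
    using cut by (simp add: words_def)
  then show ?thesis by simp
qed

section \<open>Coding a set with uniform fibers\<close>

text \<open>
  Digits start from \<open>0\<close>: the row digit \<open>b i\<close> stands for row \<open>b i + 1\<close> of the pattern \<open>D (i + 1)\<close>.
\<close>

locale bm_uniform =
  fixes m l k :: nat and D :: "nat \<Rightarrow> (nat \<times> nat) set"
  assumes l_gt_1: "1 < l" and l_less_m: "l < m" and k_ge_1: "1 \<le> k"
    and patterns: "bm_patterns m l D" and fibers: "uniform_fibers l k D"
begin

text \<open>An arbitrary numbering of the \<open>k\<close> columns that the pattern \<open>D (i + 1)\<close> keeps in row \<open>b + 1\<close>.\<close>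

definition column :: "nat \<Rightarrow> nat \<Rightarrow> nat \<Rightarrow> nat" where
  "column i b = (SOME g. bij_betw g {..<k} {a. (a, Suc b) \<in> D (Suc i)})"

text \<open>The horizontal digits of the point with row sequence \<open>b\<close> and choice sequence \<open>c\<close>.\<close>

definition digit :: "(nat \<Rightarrow> nat) \<Rightarrow> (nat \<Rightarrow> nat) \<Rightarrow> nat \<Rightarrow> nat" where
  "digit c b i = column i (b i) (c i) - 1"

text \<open>The coded points; they all lie in the Bedford-McMullen set, by \<open>point_in_bm_set\<close>.\<close>

definition point :: "(nat \<Rightarrow> nat) \<Rightarrow> (nat \<Rightarrow> nat) \<Rightarrow> real \<times> real" where
  "point c b = (expansion m (digit c b), expansion l b)"

text \<open>
  The number of row digits needed to reach the scale \<open>1/m\<^sup>n\<close>: for \<open>N = height n\<close> the numbers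
  \<open>1/l\<^sup>N\<close> and \<open>1/m\<^sup>n\<close> differ by a factor of at most \<open>l\<close>.
\<close>

definition height :: "nat \<Rightarrow> nat" where
  "height n = (LEAST N. m ^ n \<le> l ^ N)"

lemma m_ge_2: "2 \<le> m" and l_ge_2: "2 \<le> l" and m_pos: "0 < m" and l_pos: "0 < l" and k_pos: "0 < k"
  using l_gt_1 l_less_m k_ge_1 by auto

lemma column_bij:
  assumes "b < l"
  shows "bij_betw (column i b) {..<k} {a. (a, Suc b) \<in> D (Suc i)}"
proof -
  let ?S = "{a. (a, Suc b) \<in> D (Suc i)}"
  have c: "card ?S = k" using fibers assms by (auto simp: uniform_fibers_def)
  then have "finite ?S" using k_pos by (metis card.infinite less_irrefl)
  then obtain g where "bij_betw g {0..<card ?S} ?S" using ex_bij_betw_nat_finite by blast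
  then have "bij_betw g {..<k} ?S" using c by (simp add: atLeast0LessThan)
  then show ?thesis 
    unfolding column_def by (rule someI[of "\<lambda>g. bij_betw g {..<k} ?S"])
qed

lemma pattern_bounds: "(a, b) \<in> D (Suc i) \<Longrightarrow> 1 \<le> a \<and> a \<le> m \<and> 1 \<le> b \<and> b \<le> l"
  using patterns by (fastforce simp: bm_patterns_def)

lemma column_mem: "b < l \<Longrightarrow> j < k \<Longrightarrow> (column i b j, Suc b) \<in> D (Suc i)"
  using bij_betwE[OF column_bij, of b i] by blast

lemma column_bounds: "b < l \<Longrightarrow> j < k \<Longrightarrow> 1 \<le> column i b j \<and> column i b j \<le> m"
  using pattern_bounds[OF column_mem] by blast

lemma digit_less: "b i < l \<Longrightarrow> c i < k \<Longrightarrow> digit c b i < m"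
  using column_bounds[of "b i" "c i" i] m_pos unfolding digit_def by linarith

lemma digit_in_digit_seqs:
  "c \<in> digit_seqs k \<Longrightarrow> b \<in> digit_seqs l \<Longrightarrow> digit c b \<in> digit_seqs m"
  using digit_less by (simp add: digit_seqs_def)

lemma digit_cong: "c i = c' i \<Longrightarrow> b i = b' i \<Longrightarrow> digit c b i = digit c' b' i"
  by (simp add: digit_def)

lemma digit_inj:
  assumes "digit c b i = digit c' b' i" "b i = b' i" "b i < l" "c i < k" "c' i < k"
  shows "c i = c' i"
proof -
  have "column i (b i) (c i) = column i (b i) (c' i)"
    using assms(1)[unfolded digit_def, folded assms(2)]
      column_bounds[OF assms(3,4), of i] column_bounds[OF assms(3,5), of i] by linarith
  then show ?thesis
    using bij_betw_imp_inj_on[OF column_bij[of "b i" i]] assms by (simp add: inj_on_eq_iff)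
qed

lemma height_0 [simp]: "height 0 = 0"
  by (simp add: height_def)

lemma height_ge: "m ^ n \<le> l ^ height n"
proof -
  have "\<exists>N. m ^ n \<le> l ^ N"
    using l_ge_2 by (metis ex_power_ivl1 less_imp_le_nat one_le_power m_pos Suc_leI One_nat_def nat_le_linear order_trans)
  then show ?thesis unfolding height_def by (rule LeastI_ex)
qed

lemma height_le: "l ^ height n \<le> l * m ^ n"
proof (cases "height n")
  case (Suc N)
  have "\<not> m ^ n \<le> l ^ N"
    using not_less_Least[of N "\<lambda>N. m ^ n \<le> l ^ N"] Suc by (simp add: height_def)
  then show ?thesis using Suc by simp
qed (use m_pos l_pos in auto)

lemma le_height: "n \<le> height n"
proof (rule ccontr)
  assume "\<not> n \<le> height n"
  then have "l ^ height n < l ^ n" using l_gt_1 by simp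
  also have "\<dots> \<le> m ^ n" using l_less_m by (simp add: power_mono)
  finally show False using height_ge[of n] by simp
qed

lemma height_mono: "n \<le> n' \<Longrightarrow> height n \<le> height n'"
  unfolding height_def[of n]
  by (rule Least_le) (metis height_ge m_pos Suc_leI One_nat_def power_increasing order_trans)

lemma inverse_height_le: "1 / real l ^ height n \<le> 1 / real m ^ n"
  using height_ge[of n] m_pos l_pos by (intro divide_left_mono) (auto simp flip: of_nat_power)

lemma inverse_height_ge: "1 / real m ^ n \<le> real l / real l ^ height n"
proof -
  have "real l ^ height n \<le> real l * real m ^ n"
    using height_le[of n] by (simp flip: of_nat_power of_nat_mult)
  then show ?thesis using m_pos l_pos by (simp add: field_simps)
qed

lemma corners_eq_horner:
  "(x, y) \<in> bm_corners m l D n \<longleftrightarrow> (\<exists>c\<in>digit_seqs k. \<exists>b\<in>digit_seqs l.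
     x = real (horner m (digit c b) n) / real m ^ n \<and> y = real (horner l b n) / real l ^ n)"
proof (induction n arbitrary: x y)
  case 0
  have "(\<lambda>i. 0) \<in> digit_seqs k" "(\<lambda>i. 0) \<in> digit_seqs l"
    using k_pos l_pos by (auto simp: digit_seqs_def)
  then show ?case by auto
next
  case (Suc n)
  show ?case
  proof
    assume "(x, y) \<in> bm_corners m l D (Suc n)"
    then obtain x' y' a b' where *: "x = x' + (real a - 1) / real m ^ Suc n"
      "y = y' + (real b' - 1) / real l ^ Suc n" "(x', y') \<in> bm_corners m l D n" "(a, b') \<in> D (Suc n)"
      by auto
    obtain c b where cb: "c \<in> digit_seqs k" "b \<in> digit_seqs l"
      "x' = real (horner m (digit c b) n) / real m ^ n" "y' = real (horner l b n) / real l ^ n"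
      using Suc.IH *(3) by blast
    define \<beta> where "\<beta> = b' - 1"
    have \<beta>: "b' = Suc \<beta>" "\<beta> < l" and a: "1 \<le> a"
      using pattern_bounds[OF *(4)] by (auto simp: \<beta>_def)
    have "a \<in> column n \<beta> ` {..<k}"
      using bij_betw_imp_surj_on[OF column_bij[OF \<beta>(2), of n]] *(4) \<beta> by simp
    then obtain j where j: "j < k" "column n \<beta> j = a" by auto
    define c' b'' where "c' = c(n := j)" and "b'' = b(n := \<beta>)"
    have "c' \<in> digit_seqs k" "b'' \<in> digit_seqs l"
      using cb j \<beta> by (auto simp: digit_seqs_def c'_def b''_def)
    moreover have h: "horner m (digit c' b'') n = horner m (digit c b) n" "horner l b'' n = horner l b n"
      by (auto intro!: horner_cong simp: digit_def c'_def b''_def)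
    have "digit c' b'' n = a - 1" "b'' n = \<beta>"
      using j by (auto simp: digit_def c'_def b''_def)
    then have "x = real (horner m (digit c' b'') (Suc n)) / real m ^ Suc n \<and>
        y = real (horner l b'' (Suc n)) / real l ^ Suc n"
      using *(1,2) cb(3,4) \<beta> a h unfolding horner_Suc_div[OF m_pos] horner_Suc_div[OF l_pos]
      by (simp add: of_nat_diff)
    ultimately show "\<exists>c\<in>digit_seqs k. \<exists>b\<in>digit_seqs l.
     x = real (horner m (digit c b) (Suc n)) / real m ^ Suc n \<and> y = real (horner l b (Suc n)) / real l ^ Suc n"
      by blast
  next
    assume "\<exists>c\<in>digit_seqs k. \<exists>b\<in>digit_seqs l.
     x = real (horner m (digit c b) (Suc n)) / real m ^ Suc n \<and> y = real (horner l b (Suc n)) / real l ^ Suc n"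
    then obtain c b where cb: "c \<in> digit_seqs k" "b \<in> digit_seqs l"
      "x = real (horner m (digit c b) (Suc n)) / real m ^ Suc n"
      "y = real (horner l b (Suc n)) / real l ^ Suc n" by blast
    have lt: "b n < l" "c n < k" using cb by (auto simp: digit_seqs_def)
    have "(real (horner m (digit c b) n) / real m ^ n, real (horner l b n) / real l ^ n) \<in> bm_corners m l D n"
      using Suc.IH cb by blast
    moreover have "x = real (horner m (digit c b) n) / real m ^ n + (real (column n (b n) (c n)) - 1) / real m ^ Suc n"
      "y = real (horner l b n) / real l ^ n + (real (Suc (b n)) - 1) / real l ^ Suc n"
      using cb(3,4) column_bounds[OF lt, of n]
      unfolding horner_Suc_div[OF m_pos] horner_Suc_div[OF l_pos]
      by (simp_all add: digit_def of_nat_diff)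
    moreover have "(column n (b n) (c n), Suc (b n)) \<in> D (Suc n)"
      using column_mem lt by blast
    ultimately show "(x, y) \<in> bm_corners m l D (Suc n)"
      unfolding bm_corners.simps by blast
  qed
qed

lemma point_in_bm_set:
  assumes "c \<in> digit_seqs k" "b \<in> digit_seqs l"
  shows "point c b \<in> bm_set m l D"
proof -
  have "point c b \<in> bm_step m l D n" for n
  proof -
    have "(real (horner m (digit c b) n) / real m ^ n, real (horner l b n) / real l ^ n) \<in> bm_corners m l D n"
      using corners_eq_horner assms by blast
    then show ?thesis
      using expansion_bounds[OF m_ge_2 digit_in_digit_seqs[OF assms], of n]
        expansion_bounds[OF l_ge_2 assms(2), of n]
      unfolding bm_step_def point_def by force
  qed
  then show ?thesis by (simp add: bm_set_def)
qed

text \<open>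
  The closed rectangle of points whose first \<open>n\<close> horizontal and first \<open>height n\<close> vertical digits
  are given by the words \<open>cs\<close> (of length \<open>n\<close>) and \<open>bs\<close> (of length \<open>height n\<close>). Only the first
  \<open>n \<le> height n\<close> rows enter the horizontal digits.
\<close>

definition approx_square :: "nat \<Rightarrow> nat list \<Rightarrow> nat list \<Rightarrow> (real \<times> real) set" where
  "approx_square n cs bs =
    (let h = real (horner m (digit (fill 0 cs) (fill 0 bs)) n);
         v = real (horner l (fill 0 bs) (height n))
     in {h / real m ^ n..(h + 1) / real m ^ n} \<times>
        {v / real l ^ height n..(v + 1) / real l ^ height n})"

lemma horner_prefix:
  assumes "prefix c n = cs" "prefix b (height n) = bs"
  shows "horner m (digit (fill 0 cs) (fill 0 bs)) n = horner m (digit c b) n"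
    "horner l (fill 0 bs) (height n) = horner l b (height n)"
  using assms le_height[of n]
  by (auto intro!: horner_cong digit_cong simp: fill_def prefix_eq_list_iff)

lemma point_in_approx_square:
  assumes "c \<in> digit_seqs k" "b \<in> digit_seqs l" "prefix c n = cs" "prefix b (height n) = bs"
  shows "point c b \<in> approx_square n cs bs"
  using expansion_bounds[OF m_ge_2 digit_in_digit_seqs[OF assms(1,2)], of n]
    expansion_bounds[OF l_ge_2 assms(2), of "height n"]
  by (simp add: approx_square_def Let_def point_def horner_prefix[OF assms(3,4)] add_divide_distrib)

lemma dist_approx_square:
  assumes "p \<in> approx_square n cs bs" "q \<in> approx_square n cs bs"
  shows "dist p q \<le> 2 / real m ^ n"
proof -
  have "\<bar>fst p - fst q\<bar> \<le> 1 / real m ^ n" "\<bar>snd p - snd q\<bar> \<le> 1 / real l ^ height n"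
    using assms by (auto simp: approx_square_def Let_def add_divide_distrib)
  then show ?thesis
    using dist_prod_le[of p q] inverse_height_le[of n] by simp
qed

lemma bm_set_cover:
  assumes "1 \<le> n" "p \<in> bm_set m l D"
  shows "\<exists>cs\<in>words k n. \<exists>bs\<in>words l (height n). p \<in> approx_square n cs bs"
proof -
  let ?N = "height n"
  have "p \<in> bm_step m l D ?N"
    using assms le_height[of n] by (auto simp: bm_set_def)
  then obtain x y where xy: "(x, y) \<in> bm_corners m l D ?N"
      "x \<le> fst p" "fst p \<le> x + 1 / real m ^ ?N" "y \<le> snd p" "snd p \<le> y + 1 / real l ^ ?N"
    unfolding bm_step_def by force
  then obtain c b where cb: "c \<in> digit_seqs k" "b \<in> digit_seqs l"
     "x = real (horner m (digit c b) ?N) / real m ^ ?N" "y = real (horner l b ?N) / real l ^ ?N"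
    using corners_eq_horner by blast
  have "digit c b i < m" for i
    using digit_in_digit_seqs[OF cb(1,2)] by (simp add: digit_seqs_def)
  then have "real (horner m (digit c b) n) / real m ^ n \<le> fst p"
    "fst p \<le> (real (horner m (digit c b) n) + 1) / real m ^ n"
    using horner_refine[OF le_height m_pos, of n "digit c b"] xy cb(3)
    by (auto simp: add_divide_distrib intro: order_trans)
  moreover have "y \<le> snd p" "snd p \<le> (real (horner l b ?N) + 1) / real l ^ ?N"
    using xy cb(4) by (auto simp: add_divide_distrib)
  ultimately have "p \<in> approx_square n (prefix c n) (prefix b ?N)"
    by (auto simp: approx_square_def Let_def horner_prefix[OF refl refl] cb mem_Times_iff)
  then show ?thesis
    using prefix_in_words cb by blast
qed

lemma dist_point_le:
  assumes "c \<in> digit_seqs k" "b \<in> digit_seqs l" "c' \<in> digit_seqs k" "b' \<in> digit_seqs l"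
    and "\<And>i. i < n \<Longrightarrow> c i = c' i" "\<And>i. i < n \<Longrightarrow> b i = b' i"
  shows "dist (point c b) (point c' b') \<le> 1 / real m ^ n + \<bar>expansion l b - expansion l b'\<bar>"
proof -
  have "\<bar>expansion m (digit c b) - expansion m (digit c' b')\<bar> \<le> 1 / real m ^ n"
    using assms by (intro expansion_close m_ge_2 digit_in_digit_seqs digit_cong)
  then show ?thesis
    using dist_prod_le[of "point c b" "point c' b'"] by (simp add: point_def)
qed

text \<open>
  The approximate squares of level \<open>n\<close> that contain a coded point at distance at most \<open>4/m\<^sup>n\<close> from
  \<open>p\<close>. Distinct ones differ in their integer coordinates, of which the horizontal one takes at
  most \<open>11\<close> values and the vertical one at most \<open>8 * l + 3\<close>.
\<close>

definition nodes_near :: "nat \<Rightarrow> real \<times> real \<Rightarrow> (nat list \<times> nat list) set" where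
  "nodes_near n p = {(cs, bs). \<exists>c\<in>digit_seqs k. \<exists>b\<in>digit_seqs l.
     cs = prefix c n \<and> bs = prefix b (height n) \<and> dist p (point c b) \<le> 4 / real m ^ n}"

lemma card_nodes_near: "finite (nodes_near n p) \<and> card (nodes_near n p) \<le> 11 * (8 * l + 3)"
proof -
  define g where "g = (\<lambda>(cs, bs). (horner m (digit (fill 0 cs) (fill 0 bs)) n, horner l (fill 0 bs) (height n)))"
  have inj: "inj_on g (nodes_near n p)"
  proof (rule inj_onI)
    fix u v assume u: "u \<in> nodes_near n p" and v: "v \<in> nodes_near n p" and eq: "g u = g v"
    obtain c b where 1: "u = (prefix c n, prefix b (height n))" "c \<in> digit_seqs k" "b \<in> digit_seqs l"
      using u by (auto simp: nodes_near_def)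
    obtain c' b' where 2: "v = (prefix c' n, prefix b' (height n))" "c' \<in> digit_seqs k" "b' \<in> digit_seqs l"
      using v by (auto simp: nodes_near_def)
    have h: "horner m (digit c b) n = horner m (digit c' b') n"
      "horner l b (height n) = horner l b' (height n)"
      using eq 1 2 by (auto simp: g_def horner_prefix[OF refl refl])
    have b: "\<forall>i<height n. b i = b' i"
      using horner_inj[OF h(2)] 1 2 by (auto simp: digit_seqs_def)
    have "\<forall>i<n. digit c b i = digit c' b' i"
      using horner_inj[OF h(1)] digit_in_digit_seqs[OF 1(2,3)] digit_in_digit_seqs[OF 2(2,3)]
      by (auto simp: digit_seqs_def)
    then have "c i = c' i" if "i < n" for i
      using that b le_height[of n] 1(2,3) 2(2,3)
      by (intro digit_inj[of c b i c' b']) (auto simp: digit_seqs_def)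
    then show "u = v" using b 1(1) 2(1) by (simp add: prefix_eq_iff)
  qed
  define A where "A = fst ` g ` nodes_near n p"
  define B where "B = snd ` g ` nodes_near n p"
  have near: "\<bar>real (fst (g v)) - fst p * real m ^ n\<bar> \<le> real 5 \<and>
      \<bar>real (snd (g v)) - snd p * real l ^ height n\<bar> \<le> real (4 * l + 1)" if v: "v \<in> nodes_near n p" for v
  proof -
    obtain c b where 1: "v = (prefix c n, prefix b (height n))" "c \<in> digit_seqs k" "b \<in> digit_seqs l"
        "dist p (point c b) \<le> 4 / real m ^ n"
      using v by (auto simp: nodes_near_def)
    let ?X = "real (horner m (digit c b) n)" and ?Y = "real (horner l b (height n))"
    have g: "g v = (horner m (digit c b) n, horner l b (height n))"
      using 1 by (simp add: g_def horner_prefix[OF refl refl])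
    have "\<bar>fst p - expansion m (digit c b)\<bar> \<le> 4 / real m ^ n"
      using order_trans[OF dist_fst_le 1(4)] by (simp add: point_def dist_real_def)
    then have "\<bar>?X / real m ^ n - fst p\<bar> \<le> 4 / real m ^ n + 1 / real m ^ n"
      using expansion_bounds[OF m_ge_2 digit_in_digit_seqs[OF 1(2,3)], of n] by linarith
    then have X: "\<bar>?X / real m ^ n - fst p\<bar> \<le> 5 / real m ^ n"
      by (simp flip: add_divide_distrib)
    have "4 / real m ^ n \<le> 4 * real l / real l ^ height n"
      using inverse_height_ge[of n] by simp
    moreover have "\<bar>snd p - expansion l b\<bar> \<le> 4 / real m ^ n"
      using order_trans[OF dist_snd_le 1(4)] by (simp add: point_def dist_real_def)
    ultimately have "\<bar>?Y / real l ^ height n - snd p\<bar>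
        \<le> 4 * real l / real l ^ height n + 1 / real l ^ height n"
      using expansion_bounds[OF l_ge_2 1(3), of "height n"] by linarith
    then have Y: "\<bar>?Y / real l ^ height n - snd p\<bar> \<le> (4 * real l + 1) / real l ^ height n"
      by (simp flip: add_divide_distrib)
    have scale: "\<bar>z - w * q\<bar> \<le> r" if "\<bar>z / q - w\<bar> \<le> r / q" "0 < q" for z w q r :: real
    proof -
      have "z - w * q = (z / q - w) * q" using that by (simp add: field_simps)
      then have "\<bar>z - w * q\<bar> = \<bar>z / q - w\<bar> * q" using that by (simp add: abs_mult)
      also have "\<dots> \<le> r / q * q" using that by (intro mult_right_mono) auto
      finally show ?thesis using that by simp
    qed
    show ?thesis
      using scale[OF X] scale[OF Y] m_pos l_pos by (simp add: g)
  qed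
  have A: "finite A \<and> card A \<le> 2 * 5 + 1"
    by (rule nats_near_real[where x = "fst p * real m ^ n"]) (use near in \<open>auto simp: A_def\<close>)
  have B: "finite B \<and> card B \<le> 2 * (4 * l + 1) + 1"
    by (rule nats_near_real[where x = "snd p * real l ^ height n"]) (use near in \<open>auto simp: B_def\<close>)
  have sub: "g ` nodes_near n p \<subseteq> A \<times> B"
    by (auto simp: A_def B_def image_iff) (metis fst_conv, metis snd_conv)
  have "card (nodes_near n p) = card (g ` nodes_near n p)"
    using inj by (simp add: card_image)
  also have "\<dots> \<le> card A * card B"
    using card_mono[OF _ sub] A B by (simp add: card_cartesian_product)
  also have "\<dots> \<le> 11 * (8 * l + 3)"
    using A B by (intro mult_mono) auto
  finally show ?thesis
    using finite_imageD[OF finite_subset[OF sub] inj] A B by auto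
qed

section \<open>Approximate squares as nodes of a tree\<close>

text \<open>The word pairs of all approximate squares; the level of a node is the length of its first word.\<close>

definition nodes :: "(nat list \<times> nat list) set" where
  "nodes = (\<Union>n. words k n \<times> words l (height n))"

lemma nodesD:
  "v \<in> nodes \<Longrightarrow> fst v \<in> words k (length (fst v)) \<and> snd v \<in> words l (height (length (fst v)))"
  by (auto simp: nodes_def words_def)

lemma nodes_length: "v \<in> nodes \<Longrightarrow> length (snd v) = height (length (fst v))"
  by (auto simp: nodes_def words_def)

text \<open>The mass of a node under the uniform measure on the product of the digit spaces.\<close>

definition mass :: "nat list \<times> nat list \<Rightarrow> real" where
  "mass v = 1 / (real k ^ length (fst v) * real l ^ height (length (fst v)))"

text \<open>
  The nodes of a covering that lie below no other node of it of smaller level still cover, and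
  their cylinders are disjoint.
\<close>

lemma covering_refine:
  assumes A: "finite A" "A \<subseteq> nodes" "covering k l A"
  obtains A' where "A' \<subseteq> A" "covering k l A'" "(\<Sum>v\<in>A'. mass v) \<le> 1"
proof -
  let ?lev = "\<lambda>v::nat list \<times> nat list. length (fst v)"
  define above :: "nat list \<times> nat list \<Rightarrow> nat list \<times> nat list \<Rightarrow> bool" where
    "above = (\<lambda>u v. take (length (fst u)) (fst v) = fst u \<and> take (length (snd u)) (snd v) = snd u)"
  define A' where "A' = {v \<in> A. \<forall>u\<in>A. ?lev u < ?lev v \<longrightarrow> \<not> above u v}"
  have sub: "A' \<subseteq> A" by (auto simp: A'_def)
  have fin: "finite A'" using A(1) sub by (rule rev_finite_subset)
  have cov: "covering k l A'"
    unfolding covering_def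
  proof (intro ballI)
    fix c b assume cb: "c \<in> digit_seqs k" "b \<in> digit_seqs l"
    let ?hit = "\<lambda>v. prefix c (length (fst v)) = fst v \<and> prefix b (length (snd v)) = snd v"
    obtain v where v: "v \<in> A \<and> ?hit v"
      using A(3) cb unfolding covering_def by fastforce
    obtain v where v: "v \<in> A" "?hit v" and min: "\<And>u. u \<in> A \<and> ?hit u \<Longrightarrow> ?lev v \<le> ?lev u"
      using ex_has_least_nat[of "\<lambda>v. v \<in> A \<and> ?hit v", OF v, of ?lev] by blast
    have "\<not> above u v" if u: "u \<in> A" "?lev u < ?lev v" for u
    proof
      assume ab: "above u v"
      have "length (snd u) \<le> length (snd v)"
        using nodes_length[OF subsetD[OF A(2) u(1)]] nodes_length[OF subsetD[OF A(2) v(1)]]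
          height_mono[of "?lev u" "?lev v"] u(2) by simp
      then have "?hit u"
        using ab u(2) v(2) take_prefix[of "?lev u" "?lev v" c] take_prefix[of "length (snd u)" "length (snd v)" b]
        by (simp add: above_def)
      then show False using min[of u] u by simp
    qed
    then have "v \<in> A'" using v by (auto simp: A'_def)
    then show "\<exists>(xs, ys)\<in>A'. prefix c (length xs) = xs \<and> prefix b (length ys) = ys"
      using v(2) by (intro bexI[of _ v]) (auto simp: split_beta)
  qed
  define L where "L = Max (insert 0 (?lev ` A'))"
  have L: "?lev v \<le> L" if "v \<in> A'" for v
    unfolding L_def using fin that by (intro Max_ge) auto
  define leaves where "leaves = (\<lambda>v. {xs \<in> words k L. take (length (fst v)) xs = fst v} \<times>
     {ys \<in> words l (height L). take (length (snd v)) ys = snd v})"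
  have card: "real (card (leaves v)) = real k ^ L * real l ^ height L * mass v" if "v \<in> A'" for v
  proof -
    have v: "v \<in> nodes" using that sub A by auto
    note len = L[OF that] and hl = height_mono[OF L[OF that]]
    have "card (leaves v) = k ^ (L - ?lev v) * l ^ (height L - height (?lev v))"
      unfolding leaves_def card_cartesian_product using nodesD[OF v] len hl
      by (simp add: card_words_extending nodes_length[OF v])
    moreover have "real k ^ L = real k ^ (L - ?lev v) * real k ^ ?lev v"
      using len by (simp flip: power_add)
    moreover have "real l ^ height L = real l ^ (height L - height (?lev v)) * real l ^ height (?lev v)"
      using hl by (simp flip: power_add)
    ultimately show ?thesis
      using k_pos l_pos by (simp add: mass_def)
  qed
  have disj: "leaves u \<inter> leaves v = {}" if "u \<in> A'" "v \<in> A'" "?lev u \<le> ?lev v" "u \<noteq> v" for u v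
  proof (rule ccontr)
    assume "leaves u \<inter> leaves v \<noteq> {}"
    then obtain xs ys where xy: "take (length (fst u)) xs = fst u" "take (length (fst v)) xs = fst v"
      "take (length (snd u)) ys = snd u" "take (length (snd v)) ys = snd v"
      by (auto simp: leaves_def)
    have n: "u \<in> nodes" "v \<in> nodes" using that A sub by auto
    have le: "length (snd u) \<le> length (snd v)"
      using n that(3) by (simp add: nodes_length height_mono)
    have ab: "above u v"
      unfolding above_def using xy le that(3) by (metis min.absorb1 take_take)
    show False
    proof (cases "?lev u = ?lev v")
      case True
      then have "length (snd u) = length (snd v)" using n by (simp add: nodes_length)
      then have "u = v" using xy True by (metis prod_eq_iff)
      then show False using that by simp
    next
      case False
      then show False using ab that sub by (auto simp: A'_def)
    qed
  qed
  have "(\<Sum>v\<in>A'. card (leaves v)) = card (\<Union>v\<in>A'. leaves v)"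
  proof (rule card_UN_disjoint[symmetric])
    show "\<forall>i\<in>A'. \<forall>j\<in>A'. i \<noteq> j \<longrightarrow> leaves i \<inter> leaves j = {}"
      using disj by (metis Int_commute nat_le_linear)
  qed (use fin in \<open>auto simp: leaves_def\<close>)
  also have "\<dots> \<le> card (words k L \<times> words l (height L))"
    by (intro card_mono) (auto simp: leaves_def)
  also have "\<dots> = k ^ L * l ^ height L"
    by (simp add: card_cartesian_product card_words)
  finally have "real (\<Sum>v\<in>A'. card (leaves v)) \<le> real (k ^ L * l ^ height L)"
    by (rule of_nat_mono)
  then have "real k ^ L * real l ^ height L * (\<Sum>v\<in>A'. mass v) \<le> real k ^ L * real l ^ height L * 1"
    using card by (simp add: sum_distrib_left)
  then have "(\<Sum>v\<in>A'. mass v) \<le> 1"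
    using k_pos l_pos by (subst (asm) mult_le_cancel_left_pos) auto
  with sub cov show thesis by (rule that)
qed

text \<open>The dimension \<open>Q\<close>.\<close>

definition exponent :: real where
  "exponent = 1 + log (real m) (real k)"

lemma exponent_ge_1: "1 \<le> exponent"
  using m_ge_2 k_ge_1 by (simp add: exponent_def)

lemma m_powr_exponent: "real m powr (exponent - 1) = real k"
  using m_ge_2 k_ge_1 by (simp add: exponent_def)

end

section \<open>Distortion along vertical curves\<close>

text \<open>
  What the lower bound uses about a quasisymmetric map \<open>f\<close> into \<open>Y\<close>: it is injective and satisfies
  the distortion inequality with a nondecreasing control function that is small near \<open>0\<close>.
\<close>

locale bm_qs = bm_uniform +
  fixes Y :: "'a metric" and f :: "real \<times> real \<Rightarrow> 'a" and \<eta> :: "real \<Rightarrow> real"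
  assumes f_in: "x \<in> bm_set m l D \<Longrightarrow> f x \<in> mspace Y"
    and f_inj: "inj_on f (bm_set m l D)"
    and eta_mono: "0 \<le> s \<Longrightarrow> s \<le> t \<Longrightarrow> \<eta> s \<le> \<eta> t"
    and eta_0: "\<eta> 0 = 0"
    and eta_small: "0 < \<epsilon> \<Longrightarrow> \<exists>\<delta>>0. \<eta> \<delta> \<le> \<epsilon>"
    and eta_qs: "x \<in> bm_set m l D \<Longrightarrow> y \<in> bm_set m l D \<Longrightarrow> z \<in> bm_set m l D \<Longrightarrow> x \<noteq> z \<Longrightarrow>
      mdist Y (f x) (f y) \<le> \<eta> (dist x y / dist x z) * mdist Y (f x) (f z)"
begin

lemma eta_nonneg: "0 \<le> t \<Longrightarrow> 0 \<le> \<eta> t"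
  using eta_mono[of 0 t] eta_0 by simp

lemma qs_le:
  assumes "x \<in> bm_set m l D" "y \<in> bm_set m l D" "z \<in> bm_set m l D" "0 < r" "r \<le> dist x z"
    "dist x y \<le> t * r"
  shows "mdist Y (f x) (f y) \<le> \<eta> t * mdist Y (f x) (f z)"
proof -
  have "dist x y / dist x z \<le> dist x y / r"
    using assms by (intro divide_left_mono mult_pos_pos) auto
  also have "\<dots> \<le> t" using assms by (simp add: field_simps)
  finally have "\<eta> (dist x y / dist x z) \<le> \<eta> t" by (intro eta_mono) auto
  then have "\<eta> (dist x y / dist x z) * mdist Y (f x) (f z) \<le> \<eta> t * mdist Y (f x) (f z)"
    by (intro mult_right_mono) auto
  moreover have "x \<noteq> z" using assms by auto
  ultimately show ?thesis using eta_qs[OF assms(1-3)] by simp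
qed

text \<open>
  The piece of the curve \<open>b \<mapsto> point c b\<close> over the word \<open>w\<close> has a lower end, where all later row
  digits are \<open>0\<close>, and an upper end, where they are all \<open>l - 1\<close>. This is the distance between the
  images of these ends. Up to constants it is the diameter of the image of the piece.
\<close>

definition end_dist :: "(nat \<Rightarrow> nat) \<Rightarrow> nat list \<Rightarrow> real" where
  "end_dist c w = mdist Y (f (point c (fill 0 w))) (f (point c (fill (l - 1) w)))"

lemma end_dist_nonneg: "0 \<le> end_dist c w"
  by (simp add: end_dist_def)

lemma ends:
  assumes "w \<in> words l j"
  shows "fill 0 w \<in> digit_seqs l" "fill (l - 1) w \<in> digit_seqs l"
    "prefix (fill 0 w) j = w" "prefix (fill (l - 1) w) j = w"
    "expansion l (fill (l - 1) w) - expansion l (fill 0 w) = 1 / real l ^ j"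
  using assms l_pos fill_in_digit_seqs[OF assms, of 0] fill_in_digit_seqs[OF assms, of "l - 1"]
    expansion_fill_0[OF l_ge_2 assms] expansion_fill_max[OF l_ge_2 assms]
  by (simp_all add: prefix_fill words_def add_divide_distrib)

lemma column_dist_le:
  assumes "c \<in> digit_seqs k" "b \<in> digit_seqs l" "b' \<in> digit_seqs l" "prefix b j = prefix b' j"
  shows "dist (point c b) (point c b') \<le> 2 / real l ^ j"
proof -
  have eq: "b i = b' i" if "i < j" for i using assms that by (simp add: prefix_eq_iff)
  have "dist (point c b) (point c b') \<le> 1 / real m ^ j + \<bar>expansion l b - expansion l b'\<bar>"
    by (intro dist_point_le assms(1-3) eq refl)
  also have "\<dots> \<le> 1 / real l ^ j + 1 / real l ^ j"
    using l_less_m l_pos m_pos assms eq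
    by (intro add_mono expansion_close l_ge_2 divide_left_mono power_mono) auto
  finally show ?thesis by simp
qed

text \<open>
  Distances from the image of a point of the piece over \<open>w\<close> are controlled by the end distance: one
  of the two ends is at vertical distance at least half of \<open>1/l\<^sup>j\<close> from the point. The
  distortion inequality bounds the left hand side by the distance to the image of that end, and the
  latter by the distance between the images of the two ends.
\<close>

lemma far_end_control:
  assumes c: "c \<in> digit_seqs k" and w: "w \<in> words l j" and b: "b \<in> digit_seqs l" "prefix b j = w"
    and p': "p' \<in> bm_set m l D" and dist: "dist (point c b) p' \<le> t / real l ^ j"
  shows "mdist Y (f (point c b)) (f p') \<le> \<eta> (2 * t) * (\<eta> 2 * end_dist c w)"
proof -
  let ?p = "point c b" and ?z0 = "point c (fill 0 w)" and ?z1 = "point c (fill (l - 1) w)"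
  let ?r = "1 / real l ^ j"
  note e = ends[OF w]
  have r: "0 < ?r" using l_pos by simp
  have K: "?p \<in> bm_set m l D" "?z0 \<in> bm_set m l D" "?z1 \<in> bm_set m l D"
    using c b e by (auto intro: point_in_bm_set)
  have main: "mdist Y (f ?p) (f p') \<le> \<eta> (2 * t) * (\<eta> 2 * end_dist c w)"
    if z: "z \<in> bm_set m l D" "z' \<in> bm_set m l D" "mdist Y (f z) (f z') = end_dist c w"
      "?r / 2 \<le> dist ?p z" "dist ?p z \<le> 2 * ?r" "?r \<le> dist z z'" for z z'
  proof -
    have 1: "mdist Y (f ?p) (f p') \<le> \<eta> (2 * t) * mdist Y (f ?p) (f z)"
      by (rule qs_le[where r = "?r / 2"]) (use K p' z r dist in auto)
    have 2: "mdist Y (f z) (f ?p) \<le> \<eta> 2 * mdist Y (f z) (f z')"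
      by (rule qs_le[where r = ?r]) (use K z r in \<open>auto simp: dist_commute\<close>)
    have "0 \<le> t / real l ^ j" using dist zero_le_dist order_trans by blast
    moreover have "0 < real l ^ j" using l_pos by simp
    ultimately have "0 \<le> t" by (auto simp: zero_le_divide_iff)
    show ?thesis
      using order_trans[OF 1[unfolded mdist_commute[of Y "f ?p" "f z"]]
          mult_left_mono[OF 2 eta_nonneg[of "2 * t"]]] \<open>0 \<le> t\<close> z(3) by simp
  qed
  have d: "dist ?p ?z0 \<le> 2 * ?r" "dist ?p ?z1 \<le> 2 * ?r" "dist ?z0 ?z1 \<ge> ?r" "dist ?z1 ?z0 \<ge> ?r"
    using column_dist_le[OF c b(1) e(1)] column_dist_le[OF c b(1) e(2)] b e
      dist_snd_le[of ?z0 ?z1] by (auto simp: point_def dist_real_def dist_commute)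
  have "?r / 2 \<le> dist ?p ?z0 \<or> ?r / 2 \<le> dist ?p ?z1"
    using dist_snd_le[of ?p ?z0] dist_snd_le[of ?p ?z1] e(5) r
    unfolding point_def dist_real_def by auto
  then show ?thesis
  proof
    assume "?r / 2 \<le> dist ?p ?z0"
    then show ?thesis using d K by (intro main[of ?z0 ?z1]) (auto simp: end_dist_def)
  next
    assume "?r / 2 \<le> dist ?p ?z1"
    then show ?thesis using d K by (intro main[of ?z1 ?z0]) (auto simp: end_dist_def mdist_commute)
  qed
qed

lemma end_dist_pos:
  assumes "c \<in> digit_seqs k" "w \<in> words l j"
  shows "0 < end_dist c w"
proof -
  note e = ends[OF assms(2)]
  have K: "point c (fill 0 w) \<in> bm_set m l D" "point c (fill (l - 1) w) \<in> bm_set m l D"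
    using assms e by (auto intro: point_in_bm_set)
  have "point c (fill 0 w) \<noteq> point c (fill (l - 1) w)"
    using e(5) l_pos by (auto simp: point_def)
  then have "f (point c (fill 0 w)) \<noteq> f (point c (fill (l - 1) w))"
    using K f_inj by (simp add: inj_on_eq_iff)
  then have "end_dist c w \<noteq> 0"
    using K f_in by (simp add: end_dist_def)
  then show ?thesis using end_dist_nonneg[of c w] by simp
qed

text \<open>
  The upper end of a child and the lower end of the next child have the same second coordinate,
  and their first coordinates agree up to \<open>1/m\<^sup>j\<close>. The last term bounds the images of these gaps.
\<close>

lemma end_dist_le_children:
  assumes c: "c \<in> digit_seqs k" and w: "w \<in> words l j"
  shows "end_dist c w \<le> (\<Sum>d<l. end_dist c (w @ [d])) + real l * (\<eta> (2 * (real l / real m) ^ j) * (\<eta> 2 * end_dist c w))"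
proof -
  define G where "G = \<eta> (2 * (real l / real m) ^ j) * (\<eta> 2 * end_dist c w)"
  have G0: "0 \<le> G" unfolding G_def by (intro mult_nonneg_nonneg eta_nonneg end_dist_nonneg) auto
  let ?q = "\<lambda>d. point c (fill 0 (w @ [d]))" and ?r = "\<lambda>d. point c (fill (l - 1) (w @ [d]))"
  have w': "w @ [d] \<in> words l (Suc j)" if "d < l" for d
    using w that by (rule snoc_in_words)
  have K: "?q d \<in> bm_set m l D" "?r d \<in> bm_set m l D" if "d < l" for d
    using c ends[OF w'[OF that]] by (auto intro: point_in_bm_set)
  have len: "length w = j" using w by (simp add: words_def)
  have h: "horner l (fill 0 (w @ [d])) (Suc j) = l * horner l (fill 0 w) j + d" for d
    using len by (auto simp: fill_def nth_append intro!: horner_cong)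
  have gap: "mdist Y (f (?r d)) (f (?q (Suc d))) \<le> G" if "Suc d < l" for d
  proof -
    have d: "d < l" using that by simp
    note e = ends[OF w'[OF d]] and e' = ends[OF w'[OF that]]
    have "expansion l (fill (l - 1) (w @ [d])) = expansion l (fill 0 (w @ [Suc d]))"
      using expansion_fill_max[OF l_ge_2 w'[OF d]] expansion_fill_0[OF l_ge_2 w'[OF that]]
      by (simp only: h) (simp add: ac_simps)
    moreover have "dist (?r d) (?q (Suc d)) \<le> 1 / real m ^ j +
       \<bar>expansion l (fill (l - 1) (w @ [d])) - expansion l (fill 0 (w @ [Suc d]))\<bar>"
      using len by (intro dist_point_le c e e') (auto simp: fill_def nth_append)
    ultimately have "dist (?r d) (?q (Suc d)) \<le> (real l / real m) ^ j / real l ^ j"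
      using l_pos by (simp add: power_divide)
    moreover have "prefix (fill (l - 1) (w @ [d])) j = w"
      using len by (simp add: prefix_fill)
    ultimately show ?thesis
      unfolding G_def by (intro far_end_control[OF c w e(2)] K that)
  qed
  have "mdist Y (f (?q 0)) (f (?r d)) \<le> (\<Sum>i\<le>d. end_dist c (w @ [i])) + real d * G" if "d < l" for d
    using that
  proof (induction d)
    case 0
    then show ?case by (simp add: end_dist_def)
  next
    case (Suc d)
    have dl: "d < l" "0 < l" using Suc by auto
    have "mdist Y (f (?q 0)) (f (?r (Suc d))) \<le> mdist Y (f (?q 0)) (f (?r d)) + mdist Y (f (?r d)) (f (?r (Suc d)))"
      using K dl Suc.prems f_in by (intro mdist_triangle) auto
    also have "mdist Y (f (?r d)) (f (?r (Suc d))) \<le> mdist Y (f (?r d)) (f (?q (Suc d))) + end_dist c (w @ [Suc d])"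
      unfolding end_dist_def using K dl Suc.prems f_in by (intro mdist_triangle) auto
    finally show ?case
      using Suc.IH[OF dl(1)] gap[OF Suc.prems] by (simp add: algebra_simps)
  qed
  from this[of "l - 1"]
  have "mdist Y (f (?q 0)) (f (?r (l - 1))) \<le> (\<Sum>i\<le>l - 1. end_dist c (w @ [i])) + real (l - 1) * G"
    using l_pos by simp
  moreover have "fill 0 (w @ [0]) = fill 0 w" "fill (l - 1) (w @ [l - 1]) = fill (l - 1) w"
    by (auto simp: fill_def nth_append fun_eq_iff)
  moreover have "{..l - 1} = {..<l}" using l_pos by auto
  moreover have "real (l - 1) * G \<le> real l * G" using G0 by (intro mult_right_mono) auto
  ultimately show ?thesis
    unfolding G_def end_dist_def by simp
qed

text \<open>A constant that bounds the change of end distances under bounded changes of the piece.\<close>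

definition distortion :: real where
  "distortion = 1 + 2 * (\<eta> (4 * real l) * \<eta> 2)"

lemma distortion_ge_1: "1 \<le> distortion"
  unfolding distortion_def by (simp add: eta_nonneg)

lemma end_dist_le_descendant:
  assumes c: "c \<in> digit_seqs k" and w: "w \<in> words l (j + i)"
  shows "end_dist c w \<le> \<eta> (4 / real l ^ i) * (\<eta> 2 * end_dist c (take j w))"
proof -
  have t: "take j w \<in> words l j" using w by (rule take_in_words) simp
  note e = ends[OF w]
  have "dist (point c (fill 0 w)) (point c (fill (l - 1) w)) \<le> 2 / real l ^ (j + i)"
    using e by (intro column_dist_le c) auto
  then have "dist (point c (fill 0 w)) (point c (fill (l - 1) w)) \<le> (2 / real l ^ i) / real l ^ j"
    by (simp add: power_add mult.commute)
  moreover have "prefix (fill 0 w) j = take j w"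
    using w by (simp add: prefix_fill words_def)
  ultimately have "mdist Y (f (point c (fill 0 w))) (f (point c (fill (l - 1) w)))
      \<le> \<eta> (2 * (2 / real l ^ i)) * (\<eta> 2 * end_dist c (take j w))"
    by (intro far_end_control[OF c t e(1)] point_in_bm_set c e)
  then show ?thesis by (simp add: end_dist_def)
qed

lemma end_dist_le_first_child:
  assumes c: "c \<in> digit_seqs k" and w: "w \<in> words l j"
  shows "end_dist c w \<le> distortion * end_dist c (w @ [0])"
proof -
  have w': "w @ [0] \<in> words l (Suc j)" using w l_pos by (rule snoc_in_words)
  note e = ends[OF w] and e' = ends[OF w']
  have eq: "fill 0 (w @ [0]) = fill 0 w" by (auto simp: fill_def nth_append fun_eq_iff)
  have "dist (point c (fill 0 w)) (point c (fill (l - 1) w)) \<le> 2 / real l ^ j"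
    using e by (intro column_dist_le c) auto
  also have "\<dots> = (2 * real l) / real l ^ Suc j" using l_pos by simp
  finally have "mdist Y (f (point c (fill 0 w))) (f (point c (fill (l - 1) w)))
      \<le> \<eta> (2 * (2 * real l)) * (\<eta> 2 * end_dist c (w @ [0]))"
    using e'(3) unfolding eq by (intro far_end_control[OF c w' e(1)] point_in_bm_set c e)
  also have "\<dots> \<le> distortion * end_dist c (w @ [0])"
    unfolding distortion_def mult.assoc[symmetric]
    by (intro mult_right_mono end_dist_nonneg) (simp add: eta_nonneg)
  finally show ?thesis by (simp add: end_dist_def)
qed

text \<open>
  Two curves through the same approximate square have comparable end distances there.
\<close>

lemma end_dist_comparable:
  assumes c: "c \<in> digit_seqs k" "c' \<in> digit_seqs k" and eq: "prefix c n = prefix c' n"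
    and w: "w \<in> words l (height n)"
  shows "end_dist c w \<le> distortion * end_dist c' w"
proof -
  note e = ends[OF w]
  have *: "mdist Y (f (point c' (fill 0 w))) (f (point c b)) \<le> \<eta> (4 * real l) * (\<eta> 2 * end_dist c' w)"
    if b: "b \<in> digit_seqs l" "prefix b (height n) = w" for b
  proof -
    have "dist (point c' (fill 0 w)) (point c b) \<le> 2 / real m ^ n"
      using e by (intro dist_approx_square[of _ n "prefix c n" w] point_in_approx_square c b) (auto simp: eq)
    also have "\<dots> \<le> (2 * real l) / real l ^ height n"
      using inverse_height_ge[of n] by simp
    finally have "mdist Y (f (point c' (fill 0 w))) (f (point c b)) \<le> \<eta> (2 * (2 * real l)) * (\<eta> 2 * end_dist c' w)"
      by (intro far_end_control[OF c(2) w e(1,3)] point_in_bm_set c b)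
    then show ?thesis by simp
  qed
  have "end_dist c w \<le> mdist Y (f (point c (fill 0 w))) (f (point c' (fill 0 w))) +
      mdist Y (f (point c' (fill 0 w))) (f (point c (fill (l - 1) w)))"
    unfolding end_dist_def using e c by (intro mdist_triangle f_in point_in_bm_set)
  also have "\<dots> \<le> 2 * (\<eta> (4 * real l) * (\<eta> 2 * end_dist c' w))"
    using *[OF e(1,3)] *[OF e(2,4)] mdist_commute[of Y "f (point c (fill 0 w))" "f (point c' (fill 0 w))"] by simp
  also have "\<dots> \<le> distortion * end_dist c' w"
    using end_dist_nonneg[of c' w] by (simp add: distortion_def algebra_simps)
  finally show ?thesis .
qed

text \<open>The end distance of one whole curve, for reference.\<close>

definition root_dist :: real where
  "root_dist = end_dist (\<lambda>i. 0) []"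

lemma root_dist:
  assumes "c \<in> digit_seqs k"
  shows "0 < root_dist" "root_dist / distortion \<le> end_dist c []" "end_dist c [] \<le> distortion * root_dist"
proof -
  have 0: "(\<lambda>i. 0) \<in> digit_seqs k" using k_pos by (simp add: digit_seqs_def)
  have w: "[] \<in> words l (height 0)" by (simp add: words_def)
  show "0 < root_dist" unfolding root_dist_def using 0 w by (rule end_dist_pos)
  show "end_dist c [] \<le> distortion * root_dist"
    unfolding root_dist_def using assms 0 w by (intro end_dist_comparable[of _ _ 0]) (auto simp: prefix_def)
  have "root_dist \<le> distortion * end_dist c []"
    unfolding root_dist_def using assms 0 w by (intro end_dist_comparable[of _ _ 0]) (auto simp: prefix_def)
  then show "root_dist / distortion \<le> end_dist c []"
    using distortion_ge_1 by (simp add: divide_le_eq mult.commute)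
qed

text \<open>
  By \<open>end_dist_le_descendant\<close>, passing down a suitable fixed number of levels halves the end distance.
\<close>

lemma end_dist_decay:
  obtains C \<theta> where "0 < C" "0 < \<theta>" "\<theta> < 1"
    "\<And>c w j. c \<in> digit_seqs k \<Longrightarrow> w \<in> words l j \<Longrightarrow> end_dist c w \<le> C * \<theta> ^ j"
proof -
  have e2: "0 \<le> \<eta> 2" by (rule eta_nonneg) simp
  obtain \<delta> where \<delta>: "0 < \<delta>" "\<eta> \<delta> \<le> 1 / (2 * (1 + \<eta> 2))"
    using eta_small[of "1 / (2 * (1 + \<eta> 2))"] e2 by auto
  obtain i where i: "(1 / real l) ^ i < \<delta> / 4"
    using real_arch_pow_inv[of "\<delta> / 4" "1 / real l"] \<delta> l_gt_1 by auto
  define n where "n = Suc i"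
  have "4 / real l ^ n \<le> 4 / real l ^ i"
    using l_gt_1 unfolding n_def by (intro divide_left_mono power_increasing) auto
  also have "\<dots> \<le> \<delta>" using i by (simp add: power_one_over field_simps)
  finally have "\<eta> (4 / real l ^ n) \<le> 1 / (2 * (1 + \<eta> 2))"
    using eta_mono[of "4 / real l ^ n" \<delta>] \<delta> by simp
  then have "\<eta> (4 / real l ^ n) * \<eta> 2 \<le> 1 / (2 * (1 + \<eta> 2)) * \<eta> 2"
    using e2 by (rule mult_right_mono)
  also have "\<dots> \<le> 1 / 2" using e2 by (simp add: divide_le_eq)
  finally have half: "\<eta> (4 / real l ^ n) * \<eta> 2 \<le> 1 / 2" .
  define \<theta> where "\<theta> = (1 / 2 :: real) powr (1 / real n)"
  have \<theta>: "0 < \<theta>" "\<theta> < 1" "\<theta> ^ n = 1 / 2"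
  proof -
    show "0 < \<theta>" by (simp add: \<theta>_def)
    show "\<theta> < 1" unfolding \<theta>_def n_def
      using powr_less_mono'[of "1/2::real" 0 "1 / real (Suc i)"] by simp
    have "\<theta> ^ n = \<theta> powr real n" by (simp add: powr_realpow \<theta>_def)
    also have "\<dots> = (1 / 2) powr (1 / real n * real n)" by (simp only: \<theta>_def powr_powr)
    also have "\<dots> = 1 / 2" by (simp add: n_def)
    finally show "\<theta> ^ n = 1 / 2" .
  qed
  define H where "H = 1 + \<eta> 4 * (\<eta> 2 * (distortion * root_dist))"
  have r0: "0 < root_dist" using root_dist(1)[of "\<lambda>i. 0"] k_pos by (simp add: digit_seqs_def)
  have H: "1 \<le> H" unfolding H_def using r0 distortion_ge_1 e2 by (simp add: eta_nonneg)
  have bound: "end_dist c w \<le> H" if "c \<in> digit_seqs k" "w \<in> words l j" for c w j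
  proof -
    have "end_dist c w \<le> \<eta> (4 / real l ^ j) * (\<eta> 2 * end_dist c (take 0 w))"
      using that by (intro end_dist_le_descendant) auto
    also have "\<dots> \<le> \<eta> 4 * (\<eta> 2 * (distortion * root_dist))"
      using root_dist(3)[OF that(1)] e2 l_ge_2
      by (intro mult_mono eta_mono) (auto simp: eta_nonneg end_dist_nonneg divide_le_eq)
    finally show ?thesis by (simp add: H_def)
  qed
  have "end_dist c w \<le> 2 * H * \<theta> ^ j" if "c \<in> digit_seqs k" "w \<in> words l j" for c w j
    using that(2)
  proof (induction j arbitrary: w rule: less_induct)
    case (less j)
    show ?case
    proof (cases "j < n")
      case True
      have "\<theta> ^ n \<le> \<theta> ^ j" using True \<theta> by (intro power_decreasing) auto
      then have "H * 1 \<le> H * (2 * \<theta> ^ j)" using \<theta>(3) H by (intro mult_left_mono) auto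
      then show ?thesis using bound[OF that(1) less.prems] by simp
    next
      case False
      then have j: "j = (j - n) + n" by simp
      have "end_dist c w \<le> \<eta> (4 / real l ^ n) * (\<eta> 2 * end_dist c (take (j - n) w))"
        using that(1) less.prems j by (intro end_dist_le_descendant) auto
      also have "\<dots> \<le> 1 / 2 * end_dist c (take (j - n) w)"
        unfolding mult.assoc[symmetric] by (intro mult_right_mono half end_dist_nonneg)
      also have "\<dots> \<le> 1 / 2 * (2 * H * \<theta> ^ (j - n))"
        using less.prems False by (intro mult_left_mono less.IH take_in_words) (auto simp: n_def)
      also have "\<dots> = 2 * H * (\<theta> ^ (j - n) * \<theta> ^ n)" using \<theta> by simp
      also have "\<dots> = 2 * H * \<theta> ^ j" using j by (metis power_add)
      finally show ?thesis .
    qed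
  qed
  then show thesis
    using H \<theta> by (intro that[of "2 * H" \<theta>]) auto
qed

lemma end_dist_le_children_eventually:
  assumes "1 < \<kappa>"
  obtains J where "\<And>c w j. c \<in> digit_seqs k \<Longrightarrow> w \<in> words l j \<Longrightarrow> J \<le> j \<Longrightarrow>
     end_dist c w \<le> \<kappa> * (\<Sum>d<l. end_dist c (w @ [d]))"
proof -
  have e2: "0 \<le> \<eta> 2" by (rule eta_nonneg) simp
  define x where "x = (1 - 1 / \<kappa>) / (real l * (1 + \<eta> 2))"
  have x: "0 < x" using assms e2 l_pos by (simp add: x_def)
  obtain \<delta> where \<delta>: "0 < \<delta>" "\<eta> \<delta> \<le> x"
    using eta_small[OF x] by auto
  obtain J where J: "(real l / real m) ^ J < \<delta> / 2"
    using real_arch_pow_inv[of "\<delta> / 2" "real l / real m"] \<delta> l_less_m by auto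
  have "end_dist c w \<le> \<kappa> * (\<Sum>d<l. end_dist c (w @ [d]))"
    if "c \<in> digit_seqs k" "w \<in> words l j" "J \<le> j" for c w j
  proof -
    have "(real l / real m) ^ j \<le> (real l / real m) ^ J"
      using that l_less_m by (intro power_decreasing) auto
    then have "\<eta> (2 * (real l / real m) ^ j) \<le> \<eta> \<delta>"
      using J by (intro eta_mono) auto
    then have "\<eta> (2 * (real l / real m) ^ j) * (\<eta> 2 * end_dist c w) \<le> x * ((1 + \<eta> 2) * end_dist c w)"
      using \<delta> e2 x by (intro mult_mono) (auto simp: end_dist_nonneg)
    then have "real l * (\<eta> (2 * (real l / real m) ^ j) * (\<eta> 2 * end_dist c w)) \<le> real l * (x * ((1 + \<eta> 2) * end_dist c w))"
      by (intro mult_left_mono) auto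
    also have "\<dots> = (1 - 1 / \<kappa>) * end_dist c w"
      using e2 l_pos by (simp add: x_def)
    finally have "end_dist c w \<le> (\<Sum>d<l. end_dist c (w @ [d])) + (1 - 1 / \<kappa>) * end_dist c w"
      using end_dist_le_children[OF that(1,2)] by simp
    then show ?thesis using assms by (simp add: field_simps)
  qed
  then show thesis by (rule that)
qed

text \<open>
  The weights \<open>W j\<close> absorb the factors lost from one level to the next: a factor \<open>\<kappa>\<close> on
  every level, and the constant \<open>distortion\<close> on the first \<open>J\<close> levels. The exponential
  decay of end distances pays for the growth of \<open>W\<close> through the exponent \<open>t < 1\<close>.
\<close>

lemma curve_sum_lower_bound:
  assumes t: "0 < t" "t < 1"
  obtains c\<^sub>0 where "0 < c\<^sub>0"
    "\<And>c B. c \<in> digit_seqs k \<Longrightarrow> finite B \<Longrightarrow> B \<subseteq> (\<Union>j. words l j) \<Longrightarrow>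
      (\<And>b. b \<in> digit_seqs l \<Longrightarrow> \<exists>u\<in>B. prefix b (length u) = u) \<Longrightarrow>
      c\<^sub>0 \<le> (\<Sum>w\<in>B. end_dist c w powr t)"
proof -
  obtain C \<theta> where C: "0 < C" "0 < \<theta>" "\<theta> < 1"
    "\<And>c w j. c \<in> digit_seqs k \<Longrightarrow> w \<in> words l j \<Longrightarrow> end_dist c w \<le> C * \<theta> ^ j"
    by (rule end_dist_decay) blast
  define \<kappa> where "\<kappa> = 1 / (\<theta> powr (1 - t))"
  have "\<theta> powr (1 - t) < 1" using powr_less_mono'[of \<theta> 0 "1 - t"] C t by simp
  then have \<kappa>: "1 < \<kappa>" using C by (simp add: \<kappa>_def)
  obtain J where J: "\<And>c w j. c \<in> digit_seqs k \<Longrightarrow> w \<in> words l j \<Longrightarrow> J \<le> j \<Longrightarrow>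
     end_dist c w \<le> \<kappa> * (\<Sum>d<l. end_dist c (w @ [d]))"
    using end_dist_le_children_eventually[OF \<kappa>] by blast
  define W where "W = (\<lambda>j. distortion ^ min j J * \<kappa> ^ j)"
  have W0: "0 < W j" for j using distortion_ge_1 \<kappa> by (simp add: W_def)
  have step: "W (length w) * end_dist c w \<le> (\<Sum>d<l. W (length (w @ [d])) * end_dist c (w @ [d]))"
    if "c \<in> digit_seqs k" "w \<in> words l j" for c w j
  proof -
    have len: "length w = j" using that by (simp add: words_def)
    let ?S = "\<Sum>d<l. end_dist c (w @ [d])"
    have S: "0 \<le> ?S" by (intro sum_nonneg end_dist_nonneg)
    have "W j * end_dist c w \<le> W (Suc j) * ?S"
    proof (cases "J \<le> j")
      case True
      have "W j * end_dist c w \<le> W j * (\<kappa> * ?S)"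
        using J[OF that True] W0[of j] by (intro mult_left_mono) auto
      also have "\<dots> = W (Suc j) * ?S" using True by (simp add: W_def min_def)
      finally show ?thesis .
    next
      case False
      have "end_dist c (w @ [0]) \<le> ?S"
        using l_pos by (intro member_le_sum end_dist_nonneg) auto
      then have "distortion * end_dist c (w @ [0]) \<le> distortion * ?S"
        using distortion_ge_1 by (intro mult_left_mono) auto
      then have "end_dist c w \<le> distortion * ?S"
        using end_dist_le_first_child[OF that] by simp
      then have "W j * end_dist c w \<le> W j * (distortion * ?S)"
        using W0[of j] by (intro mult_left_mono) auto
      also have "\<dots> \<le> \<kappa> * (W j * (distortion * ?S))"
        using \<kappa> W0[of j] S distortion_ge_1 mult_right_mono[of 1 \<kappa> "W j * (distortion * ?S)"] by simp
      also have "\<dots> = W (Suc j) * ?S" using False by (simp add: W_def min_def)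
      finally show ?thesis .
    qed
    then show ?thesis by (simp add: len sum_distrib_left)
  qed
  define A where "A = distortion ^ J * C powr (1 - t)"
  have A: "0 < A" using distortion_ge_1 C by (simp add: A_def)
  have weight: "W (length w) * end_dist c w \<le> A * end_dist c w powr t"
    if "c \<in> digit_seqs k" "w \<in> words l j" for c w j
  proof -
    have len: "length w = j" using that by (simp add: words_def)
    have s: "0 < end_dist c w" using that by (rule end_dist_pos)
    have "end_dist c w powr (1 - t) \<le> (C * \<theta> ^ j) powr (1 - t)"
      using C(4)[OF that] s t by (intro powr_mono2) auto
    also have "\<dots> = C powr (1 - t) * (\<theta> powr (1 - t)) ^ j"
      using C by (simp add: powr_mult flip: powr_realpow powr_powr) (simp add: powr_powr mult.commute)
    finally have "\<kappa> ^ j * end_dist c w powr (1 - t) \<le> \<kappa> ^ j * (C powr (1 - t) * (\<theta> powr (1 - t)) ^ j)"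
      using \<kappa> by (intro mult_left_mono) auto
    also have "\<dots> = C powr (1 - t)"
      using C by (simp add: \<kappa>_def power_one_over)
    finally have 1: "\<kappa> ^ j * end_dist c w powr (1 - t) \<le> C powr (1 - t)" .
    have "W j \<le> distortion ^ J * \<kappa> ^ j"
      unfolding W_def using distortion_ge_1 \<kappa> by (intro mult_right_mono power_increasing) auto
    then have "W j * end_dist c w powr (1 - t) \<le> distortion ^ J * \<kappa> ^ j * end_dist c w powr (1 - t)"
      by (intro mult_right_mono) auto
    also have "\<dots> \<le> A"
      unfolding A_def mult.assoc using distortion_ge_1 by (intro mult_left_mono 1) auto
    finally have "W j * end_dist c w powr (1 - t) * end_dist c w powr t \<le> A * end_dist c w powr t"
      by (intro mult_right_mono) auto
    moreover have "end_dist c w powr (1 - t) * end_dist c w powr t = end_dist c w"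
      using s by (simp flip: powr_add)
    ultimately show ?thesis by (simp add: len mult.assoc)
  qed
  define c\<^sub>0 where "c\<^sub>0 = root_dist / distortion / A"
  have r0: "0 < root_dist" using root_dist(1)[of "\<lambda>i. 0"] k_pos by (simp add: digit_seqs_def)
  have "c\<^sub>0 \<le> (\<Sum>w\<in>B. end_dist c w powr t)"
    if c: "c \<in> digit_seqs k" and B: "finite B" "B \<subseteq> (\<Union>j. words l j)"
      and cut: "\<And>b. b \<in> digit_seqs l \<Longrightarrow> \<exists>u\<in>B. prefix b (length u) = u" for c B
  proof -
    have "root_dist / distortion \<le> W 0 * end_dist c []"
      using root_dist(2)[OF c] by (simp add: W_def)
    also have "\<dots> \<le> (\<Sum>w\<in>B. W (length w) * end_dist c w)"
      using tree_cut_sum[where g = "\<lambda>w. W (length w) * end_dist c w", OF l_pos B(1) _ step[OF c] cut]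
        W0 end_dist_nonneg by (simp add: less_imp_le)
    also have "\<dots> \<le> (\<Sum>w\<in>B. A * end_dist c w powr t)"
      using weight[OF c] B(2) by (intro sum_mono) blast
    also have "\<dots> = (\<Sum>w\<in>B. end_dist c w powr t) * A"
      by (simp add: sum_distrib_left mult.commute)
    finally show ?thesis using A by (simp only: c\<^sub>0_def pos_divide_le_eq)
  qed
  moreover have "0 < c\<^sub>0" using r0 distortion_ge_1 A by (simp add: c\<^sub>0_def)
  ultimately show thesis using that by blast
qed

section \<open>Averaging over the vertical curves\<close>

text \<open>
  The size of the image of an approximate square, measured along the curve whose choices after the
  given word are all \<open>0\<close>.
\<close>

definition node_dist :: "nat list \<times> nat list \<Rightarrow> real" where
  "node_dist v = end_dist (fill 0 (fst v)) (snd v)"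

lemma node_dist_nonneg: "0 \<le> node_dist v"
  by (simp add: node_dist_def end_dist_nonneg)

text \<open>
  A covering restricts to a cut set on every curve. The curves are sampled by the words of choices
  of the largest length \<open>L\<close> that occurs; a node of level \<open>n\<close> is met by \<open>k ^ (L - n)\<close> of them.
\<close>

lemma covering_average_lower_bound:
  assumes t: "0 < t" "t < 1"
  obtains c\<^sub>1 where "0 < c\<^sub>1" "\<And>A. finite A \<Longrightarrow> A \<subseteq> nodes \<Longrightarrow> covering k l A \<Longrightarrow>
    c\<^sub>1 \<le> (\<Sum>v\<in>A. node_dist v powr t / real k ^ length (fst v))"
proof -
  obtain c\<^sub>0 where c\<^sub>0: "0 < c\<^sub>0"
    "\<And>c B. c \<in> digit_seqs k \<Longrightarrow> finite B \<Longrightarrow> B \<subseteq> (\<Union>j. words l j) \<Longrightarrow>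
      (\<And>b. b \<in> digit_seqs l \<Longrightarrow> \<exists>u\<in>B. prefix b (length u) = u) \<Longrightarrow>
      c\<^sub>0 \<le> (\<Sum>w\<in>B. end_dist c w powr t)"
    by (rule curve_sum_lower_bound[OF t]) blast
  define c\<^sub>1 where "c\<^sub>1 = c\<^sub>0 / distortion powr t"
  have d0: "0 < distortion powr t" using distortion_ge_1 by simp
  have "c\<^sub>1 \<le> (\<Sum>v\<in>A. node_dist v powr t / real k ^ length (fst v))"
    if A: "finite A" "A \<subseteq> nodes" "covering k l A" for A
  proof -
    define L where "L = Max (insert 0 ((\<lambda>v. length (fst v)) ` A))"
    have L: "length (fst v) \<le> L" if "v \<in> A" for v
      unfolding L_def using A(1) that by (intro Max_ge) auto
    have curve: "c\<^sub>1 \<le> (\<Sum>v | v \<in> A \<and> take (length (fst v)) cs = fst v. node_dist v powr t)"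
      if cs: "cs \<in> words k L" for cs
    proof -
      let ?c = "fill 0 cs" and ?S = "{v \<in> A. take (length (fst v)) cs = fst v}"
      have c: "?c \<in> digit_seqs k" using cs k_pos by (rule fill_in_digit_seqs)
      have lcs: "length cs = L" using cs by (simp add: words_def)
      have pre: "prefix ?c (length (fst v)) = take (length (fst v)) cs" if "v \<in> A" for v
        using L[OF that] lcs by (intro prefix_fill) simp
      have fin: "finite ?S" using A by simp
      have "c\<^sub>0 \<le> (\<Sum>w\<in>snd ` ?S. end_dist ?c w powr t)"
      proof (rule c\<^sub>0(2)[OF c])
        show "snd ` ?S \<subseteq> (\<Union>j. words l j)"
          using A(2) nodesD by blast
        show "\<exists>u\<in>snd ` ?S. prefix b (length u) = u" if b: "b \<in> digit_seqs l" for b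
        proof -
          obtain v where v: "v \<in> A" "prefix ?c (length (fst v)) = fst v" "prefix b (length (snd v)) = snd v"
            using A(3) c b unfolding covering_def by fastforce
          then show ?thesis using pre by (intro bexI[of _ "snd v"]) auto
        qed
      qed (use fin in simp)
      also have "\<dots> \<le> (\<Sum>v\<in>?S. end_dist ?c (snd v) powr t)"
        using sum_image_le[OF fin, of "\<lambda>w. end_dist ?c w powr t" snd] by (simp add: o_def)
      also have "\<dots> \<le> (\<Sum>v\<in>?S. distortion powr t * node_dist v powr t)"
      proof (rule sum_mono)
        fix v assume v: "v \<in> ?S"
        then have n: "fst v \<in> words k (length (fst v))" "snd v \<in> words l (height (length (fst v)))"
          using nodesD[OF subsetD[OF A(2)], of v] by auto
        have "prefix ?c (length (fst v)) = prefix (fill 0 (fst v)) (length (fst v))"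
          using v pre by (simp add: prefix_fill)
        then have "end_dist ?c (snd v) \<le> distortion * node_dist v"
          unfolding node_dist_def using n k_pos by (intro end_dist_comparable c fill_in_digit_seqs)
        then have "end_dist ?c (snd v) powr t \<le> (distortion * node_dist v) powr t"
          using t end_dist_nonneg by (intro powr_mono2) auto
        then show "end_dist ?c (snd v) powr t \<le> distortion powr t * node_dist v powr t"
          using distortion_ge_1 node_dist_nonneg by (simp add: powr_mult)
      qed
      also have "\<dots> = (\<Sum>v\<in>?S. node_dist v powr t) * distortion powr t"
        by (simp add: sum_distrib_left mult.commute)
      finally show ?thesis
        unfolding c\<^sub>1_def using d0 by (simp only: pos_divide_le_eq)
    qed
    have "real k ^ L * c\<^sub>1 = (\<Sum>cs\<in>words k L. c\<^sub>1)"
      by (simp add: card_words)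
    also have "\<dots> \<le> (\<Sum>cs\<in>words k L. \<Sum>v | v \<in> A \<and> take (length (fst v)) cs = fst v. node_dist v powr t)"
      by (intro sum_mono curve)
    also have "\<dots> = (\<Sum>v\<in>A. \<Sum>cs | cs \<in> words k L \<and> take (length (fst v)) cs = fst v. node_dist v powr t)"
      by (rule sum.swap_restrict) (use A in auto)
    also have "\<dots> = (\<Sum>v\<in>A. real k ^ L * (node_dist v powr t / real k ^ length (fst v)))"
    proof (rule sum.cong[OF refl])
      fix v assume v: "v \<in> A"
      have "card {cs \<in> words k L. take (length (fst v)) cs = fst v} = k ^ (L - length (fst v))"
        using nodesD[OF subsetD[OF A(2) v]] L[OF v] by (intro card_words_extending) auto
      moreover have "real k ^ L = real k ^ (L - length (fst v)) * real k ^ length (fst v)"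
        using L[OF v] by (simp flip: power_add)
      ultimately show "(\<Sum>cs | cs \<in> words k L \<and> take (length (fst v)) cs = fst v. node_dist v powr t) =
          real k ^ L * (node_dist v powr t / real k ^ length (fst v))"
        using k_pos by simp
    qed
    also have "\<dots> = real k ^ L * (\<Sum>v\<in>A. node_dist v powr t / real k ^ length (fst v))"
      by (simp add: sum_distrib_left)
    finally show ?thesis using k_pos by simp
  qed
  moreover have "0 < c\<^sub>1" using c\<^sub>0 d0 by (simp add: c\<^sub>1_def)
  ultimately show thesis using that by blast
qed

text \<open>
  The tangent bound is applied to \<open>x = l ^ height n * node_dist v powr t\<close> on a disjoint subcovering,
  weighted by the masses. Since \<open>l ^ height n\<close> is at most \<open>l * m ^ n\<close> and \<open>m powr (Q - 1) = k\<close>,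
  the mass times \<open>x powr Q\<close> is at most a constant times \<open>node_dist v powr s\<close> with \<open>s = t * Q\<close>.
\<close>

lemma covering_sum_lower_bound:
  assumes s: "0 < s" "s < exponent"
  obtains c\<^sub>2 where "0 < c\<^sub>2" "\<And>A. finite A \<Longrightarrow> A \<subseteq> nodes \<Longrightarrow> covering k l A \<Longrightarrow>
    c\<^sub>2 \<le> (\<Sum>v\<in>A. node_dist v powr s)"
proof -
  define t where "t = s / exponent"
  have t: "0 < t" "t < 1" "t * exponent = s"
    using s exponent_ge_1 by (auto simp: t_def)
  obtain c\<^sub>1 where c\<^sub>1: "0 < c\<^sub>1" "\<And>A. finite A \<Longrightarrow> A \<subseteq> nodes \<Longrightarrow> covering k l A \<Longrightarrow>
    c\<^sub>1 \<le> (\<Sum>v\<in>A. node_dist v powr t / real k ^ length (fst v))"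
    by (rule covering_average_lower_bound[OF t(1,2)]) blast
  define a where "a = c\<^sub>1 / 2"
  have a: "0 < a" using c\<^sub>1 by (simp add: a_def)
  define E where "E = a powr (1 - exponent) * real l powr (exponent - 1)"
  have E: "0 < E" using a l_pos by (simp add: E_def)
  have "a / E \<le> (\<Sum>v\<in>A. node_dist v powr s)"
    if A: "finite A" "A \<subseteq> nodes" "covering k l A" for A
  proof -
    obtain A' where A': "A' \<subseteq> A" "covering k l A'" "(\<Sum>v\<in>A'. mass v) \<le> 1"
      using covering_refine[OF A] by blast
    have fin: "finite A'" using A'(1) A(1) by (rule finite_subset)
    have node_term: "node_dist v powr t / real k ^ length (fst v) \<le> a * mass v + E * node_dist v powr s"
      if "v \<in> A'" for v
    proof -
      let ?n = "length (fst v)"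
      let ?M = "real l ^ height ?n"
      define x where "x = ?M * node_dist v powr t"
      have M0: "0 < ?M" using l_pos by simp
      have mass0: "0 \<le> mass v" by (simp add: mass_def)
      have "?M \<le> real l * real m ^ ?n"
        using height_le[of ?n] by (simp flip: of_nat_power of_nat_mult)
      then have "?M powr (exponent - 1) \<le> (real l * real m ^ ?n) powr (exponent - 1)"
        using M0 exponent_ge_1 by (intro powr_mono2) auto
      also have "\<dots> = real l powr (exponent - 1) * (real m powr (exponent - 1)) ^ ?n"
      proof -
        have "(real m ^ ?n) powr (exponent - 1) = real m powr (real ?n * (exponent - 1))"
          using m_pos by (simp add: powr_powr flip: powr_realpow)
        also have "\<dots> = (real m powr (exponent - 1)) ^ ?n"
          using m_pos by (simp add: powr_power mult.commute)
        finally show ?thesis using l_pos m_pos by (simp add: powr_mult)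
      qed
      also have "\<dots> = real l powr (exponent - 1) * real k ^ ?n"
        by (simp add: m_powr_exponent)
      finally have Mp: "?M powr (exponent - 1) \<le> real l powr (exponent - 1) * real k ^ ?n" .
      have xp: "x powr exponent = ?M * ?M powr (exponent - 1) * node_dist v powr s"
        unfolding x_def using M0 t(3) by (simp add: powr_mult powr_powr powr_diff node_dist_nonneg)
      have "mass v * x powr exponent = ?M powr (exponent - 1) / real k ^ ?n * node_dist v powr s"
        unfolding xp mass_def using l_pos by simp
      also have "\<dots> \<le> real l powr (exponent - 1) * node_dist v powr s"
        using Mp k_pos by (intro mult_right_mono) (auto simp: pos_divide_le_eq)
      finally have mx: "mass v * x powr exponent \<le> real l powr (exponent - 1) * node_dist v powr s" .
      have "node_dist v powr t / real k ^ ?n = mass v * x"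
        using l_pos by (simp add: mass_def x_def)
      also have "\<dots> \<le> mass v * (a + a powr (1 - exponent) * x powr exponent)"
        using mass0 a exponent_ge_1 by (intro mult_left_mono powr_tangent_bound) (auto simp: x_def)
      also have "\<dots> = a * mass v + a powr (1 - exponent) * (mass v * x powr exponent)"
        by (simp add: algebra_simps)
      also have "\<dots> \<le> a * mass v + a powr (1 - exponent) * (real l powr (exponent - 1) * node_dist v powr s)"
        by (intro add_left_mono mult_left_mono mx) auto
      finally show ?thesis by (simp add: E_def mult.assoc)
    qed
    have "c\<^sub>1 \<le> (\<Sum>v\<in>A'. node_dist v powr t / real k ^ length (fst v))"
      using c\<^sub>1(2)[OF fin] A' A by auto
    also have "\<dots> \<le> (\<Sum>v\<in>A'. a * mass v + E * node_dist v powr s)"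
      by (intro sum_mono node_term)
    also have "\<dots> = a * (\<Sum>v\<in>A'. mass v) + E * (\<Sum>v\<in>A'. node_dist v powr s)"
      by (simp add: sum.distrib sum_distrib_left)
    also have "a * (\<Sum>v\<in>A'. mass v) \<le> a * 1"
      using A'(3) a by (intro mult_left_mono) auto
    finally have "a \<le> E * (\<Sum>v\<in>A'. node_dist v powr s)" by (simp add: a_def)
    also have "\<dots> \<le> E * (\<Sum>v\<in>A. node_dist v powr s)"
      using E A A' by (intro mult_left_mono sum_mono2) auto
    finally show ?thesis using E by (simp add: pos_divide_le_eq mult.commute)
  qed
  moreover have "0 < a / E" using a E by simp
  ultimately show thesis using that by blast
qed

section \<open>Hausdorff dimension of quasisymmetric images\<close>

lemma nodes_near_subset: "nodes_near n p \<subseteq> nodes"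
  unfolding nodes_near_def nodes_def using prefix_in_words by fastforce

text \<open>
  The level \<open>n\<close> is chosen so that \<open>1/m\<^sup>n\<close> is comparable to the diameter of the preimage of \<open>U\<close>. The
  slack \<open>\<epsilon>\<close> is needed for sets \<open>U\<close> with a single preimage, for which \<open>r\<close> may be
  \<open>0\<close>; there \<open>n\<close> is taken large instead.
\<close>

lemma cover_set_by_nodes:
  assumes s: "0 < s"
  obtains C where "0 < C"
    "\<And>U \<epsilon> r. (\<And>x y. x \<in> U \<Longrightarrow> y \<in> U \<Longrightarrow> mdist Y x y \<le> r) \<Longrightarrow> 0 \<le> r \<Longrightarrow> 0 < \<epsilon> \<Longrightarrow>
      \<exists>F \<subseteq> nodes. finite F \<and> (\<Sum>v\<in>F. node_dist v powr s) \<le> C * r powr s + \<epsilon> \<and>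
        (\<forall>c\<in>digit_seqs k. \<forall>b\<in>digit_seqs l. f (point c b) \<in> U \<longrightarrow>
          (\<exists>(xs, ys)\<in>F. prefix c (length xs) = xs \<and> prefix b (length ys) = ys))"
proof -
  define M where "M = real (11 * (8 * l + 3))"
  define C where "C = M * (2 * \<eta> (3 * real m) + 1) powr s"
  have e0: "0 \<le> \<eta> (3 * real m)" by (simp add: eta_nonneg)
  have M0: "0 < M" by (simp add: M_def)
  have C0: "0 < C" using e0 M0 by (simp add: C_def)
  have main: "\<exists>F \<subseteq> nodes. finite F \<and> (\<Sum>v\<in>F. node_dist v powr s) \<le> C * r powr s + \<epsilon> \<and>
        (\<forall>c\<in>digit_seqs k. \<forall>b\<in>digit_seqs l. f (point c b) \<in> U \<longrightarrow>
          (\<exists>(xs, ys)\<in>F. prefix c (length xs) = xs \<and> prefix b (length ys) = ys))"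
    if U: "\<And>x y. x \<in> U \<Longrightarrow> y \<in> U \<Longrightarrow> mdist Y x y \<le> r" and r: "0 \<le> r" and \<epsilon>: "0 < \<epsilon>" for U \<epsilon> r
  proof -
    define E where "E = {point c b | c b. c \<in> digit_seqs k \<and> b \<in> digit_seqs l \<and> f (point c b) \<in> U}"
    have E_K: "E \<subseteq> bm_set m l D" by (auto simp: E_def point_in_bm_set)
    have nodes_sum: "(\<Sum>v\<in>nodes_near n p. node_dist v powr s) \<le> M * h powr s"
      if "\<And>v. v \<in> nodes_near n p \<Longrightarrow> node_dist v \<le> h" "0 \<le> h" for n p h
    proof -
      have "(\<Sum>v\<in>nodes_near n p. node_dist v powr s) \<le> real (card (nodes_near n p)) * h powr s"
        using that s node_dist_nonneg by (intro sum_bounded_above powr_mono2) auto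
      also have "\<dots> \<le> M * h powr s"
        unfolding M_def using card_nodes_near[of n p] by (intro mult_right_mono) (auto simp del: of_nat_mult)
      finally show ?thesis .
    qed
    have hit: "\<exists>(xs, ys)\<in>nodes_near n p. prefix c (length xs) = xs \<and> prefix b (length ys) = ys"
      if "c \<in> digit_seqs k" "b \<in> digit_seqs l" "dist p (point c b) \<le> 4 / real m ^ n" for n p c b
      using that by (intro bexI[of _ "(prefix c n, prefix b (height n))"]) (auto simp: nodes_near_def)
    show ?thesis
    proof (cases "E = {}")
      case True
      then have "f (point c b) \<notin> U" if "c \<in> digit_seqs k" "b \<in> digit_seqs l" for c b
        using that unfolding E_def by blast
      then show ?thesis
        using C0 \<epsilon> by (intro exI[of _ "{}"]) (auto simp: add_nonneg_pos less_imp_le)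
    next
      case False
      then obtain p where p: "p \<in> E" by auto
      show ?thesis
      proof (cases "E = {p}")
        case True
        obtain K \<theta> where K: "0 < K" "0 < \<theta>" "\<theta> < 1"
          "\<And>c w j. c \<in> digit_seqs k \<Longrightarrow> w \<in> words l j \<Longrightarrow> end_dist c w \<le> K * \<theta> ^ j"
          by (rule end_dist_decay) blast
        define \<epsilon>' where "\<epsilon>' = (\<epsilon> / M) powr (1 / s)"
        have \<epsilon>': "0 < \<epsilon>'" "\<epsilon>' powr s = \<epsilon> / M" using \<epsilon> M0 s by (auto simp: \<epsilon>'_def powr_powr)
        obtain n where n: "\<theta> ^ n < \<epsilon>' / K"
          using real_arch_pow_inv[of "\<epsilon>' / K" \<theta>] K \<epsilon>' by auto
        have "node_dist v \<le> \<epsilon>'" if "v \<in> nodes_near n p" for v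
        proof -
          have v: "fst v \<in> words k n" "snd v \<in> words l (height n)"
            using that by (auto simp: nodes_near_def prefix_in_words)
          have "node_dist v \<le> K * \<theta> ^ height n"
            unfolding node_dist_def by (intro K(4) fill_in_digit_seqs[OF v(1)] k_pos v(2))
          also have "\<dots> \<le> K * \<theta> ^ n"
            using K le_height[of n] by (intro mult_left_mono power_decreasing) auto
          also have "\<dots> \<le> \<epsilon>'" using n K by (simp add: field_simps)
          finally show ?thesis .
        qed
        from nodes_sum[OF this] \<epsilon>' have "(\<Sum>v\<in>nodes_near n p. node_dist v powr s) \<le> \<epsilon>"
          using M0 by simp
        moreover have "0 \<le> C * r powr s" using C0 by simp
        moreover have "point c b = p" if "c \<in> digit_seqs k" "b \<in> digit_seqs l" "f (point c b) \<in> U" for c b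
          using that True by (auto simp: E_def)
        ultimately show ?thesis
          using nodes_near_subset[of n p] card_nodes_near[of n p]
          by (intro exI[of _ "nodes_near n p"]) (auto intro!: hit)
      next
        case False
        have small: "dist x y \<le> 2" if "x \<in> E" "y \<in> E" for x y
        proof -
          have "z \<in> approx_square 0 [] []" if "z \<in> E" for z
            using that by (auto simp: E_def prefix_def intro!: point_in_approx_square)
          then show ?thesis using dist_approx_square[of x 0 "[]" "[]" y] that by simp
        qed
        \<comment> \<open>A point \<open>q\<close> of \<open>E\<close> at least half as far from \<open>p\<close> as any other serves to compare distances.\<close>
        define \<rho> where "\<rho> = (SUP x\<in>E. dist p x)"
        have bdd: "bdd_above (dist p ` E)" using small[OF p] by (intro bdd_aboveI2[of _ _ 2])
        have le_\<rho>: "dist p x \<le> \<rho>" if "x \<in> E" for x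
          unfolding \<rho>_def using that bdd by (rule cSUP_upper)
        obtain q' where q': "q' \<in> E" "q' \<noteq> p" using False p by blast
        then have "0 < dist p q'" by simp
        then have \<rho>: "0 < \<rho>" using le_\<rho>[OF q'(1)] by linarith
        then have "\<rho> / 2 < (SUP x\<in>E. dist p x)" by (simp add: \<rho>_def)
        moreover have "E \<noteq> {}" using p by blast
        ultimately have "\<exists>x\<in>E. \<rho> / 2 < dist p x"
          using less_cSUP_iff[OF _ bdd, of "\<rho> / 2"] by blast
        then obtain q where q: "q \<in> E" "\<rho> / 2 < dist p q" by blast
        define R where "R = dist p q"
        have R: "0 < R" "R \<le> 2" using q \<rho> small[OF p q(1)] by (auto simp: R_def)
        have inR: "dist p x \<le> 2 * R" if "x \<in> E" for x
          using le_\<rho>[OF that] q by (simp add: R_def)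
        obtain i where i: "(1 / real m) ^ i < R / 2"
          using real_arch_pow_inv[of "R / 2" "1 / real m"] R m_ge_2 by auto
        have ex: "2 / real m ^ Suc i < R"
        proof -
          have "2 / real m ^ Suc i \<le> 2 / real m ^ i"
            using m_ge_2 by (intro divide_left_mono power_increasing) auto
          then show ?thesis using i by (simp add: power_one_over)
        qed
        define n where "n = (LEAST n. 2 / real m ^ Suc n < R)"
        have n1: "2 / real m ^ Suc n < R" unfolding n_def by (rule LeastI[of _ i]) (rule ex)
        have n2: "R \<le> 2 / real m ^ n"
        proof (cases n)
          case (Suc n')
          then have "\<not> 2 / real m ^ Suc n' < R"
            using not_less_Least[of n' "\<lambda>n. 2 / real m ^ Suc n < R"] by (simp add: n_def)
          then show ?thesis by (simp add: Suc)
        qed (use R in simp)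
        have m6: "6 / real m ^ n \<le> 3 * real m * R"
        proof -
          have "6 / real m ^ n = 3 * real m * (2 / real m ^ Suc n)" using m_pos by simp
          also have "\<dots> \<le> 3 * real m * R" using n1 by (intro mult_left_mono) auto
          finally show ?thesis .
        qed
        have "node_dist v \<le> 2 * (\<eta> (3 * real m) * r)" if v: "v \<in> nodes_near n p" for v
        proof -
          obtain c b where cb: "v = (prefix c n, prefix b (height n))" "c \<in> digit_seqs k" "b \<in> digit_seqs l"
            "dist p (point c b) \<le> 4 / real m ^ n"
            using v by (auto simp: nodes_near_def)
          let ?c = "fill 0 (fst v)"
          have w: "fst v \<in> words k n" "snd v \<in> words l (height n)"
            using cb by (auto simp: prefix_in_words)
          have c': "?c \<in> digit_seqs k" using w(1) k_pos by (rule fill_in_digit_seqs)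
          have pc: "prefix ?c n = fst v" using w by (simp add: prefix_fill words_def)
          have *: "mdist Y (f p) (f (point ?c b')) \<le> \<eta> (3 * real m) * r"
            if b': "b' \<in> digit_seqs l" "prefix b' (height n) = snd v" for b'
          proof -
            have "dist (point c b) (point ?c b') \<le> 2 / real m ^ n"
              using cb pc b' c' by (intro dist_approx_square[of _ n "fst v" "snd v"] point_in_approx_square) auto
            then have "dist p (point ?c b') \<le> 4 / real m ^ n + 2 / real m ^ n"
              using cb(4) dist_triangle[of p "point ?c b'" "point c b"] by simp
            also have "\<dots> = 6 / real m ^ n" by (subst add_divide_distrib[symmetric]) simp
            finally have "dist p (point ?c b') \<le> 3 * real m * R" using m6 by simp
            then have "mdist Y (f p) (f (point ?c b')) \<le> \<eta> (3 * real m) * mdist Y (f p) (f q)"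
              using p q E_K R b' c' by (intro qs_le[where r = R] point_in_bm_set) (auto simp: R_def)
            also have "\<dots> \<le> \<eta> (3 * real m) * r"
              using p q e0 by (intro mult_left_mono U) (auto simp: E_def)
            finally show ?thesis .
          qed
          note e = ends[OF w(2)]
          have "node_dist v \<le> mdist Y (f (point ?c (fill 0 (snd v)))) (f p) +
               mdist Y (f p) (f (point ?c (fill (l - 1) (snd v))))"
            unfolding node_dist_def end_dist_def using e c' p E_K
            by (intro mdist_triangle f_in point_in_bm_set) auto
          then show ?thesis
            using *[OF e(1,3)] *[OF e(2,4)] mdist_commute[of Y "f p" "f (point ?c (fill 0 (snd v)))"] by simp
        qed
        from nodes_sum[OF this]
        have "(\<Sum>v\<in>nodes_near n p. node_dist v powr s) \<le> M * (2 * (\<eta> (3 * real m) * r)) powr s"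
          using r e0 by simp
        also have "\<dots> \<le> M * ((2 * \<eta> (3 * real m) + 1) * r) powr s"
          using r e0 s M0 by (intro mult_left_mono powr_mono2) (auto simp: algebra_simps)
        also have "\<dots> = C * r powr s"
          using r e0 by (simp add: C_def powr_mult)
        finally have "(\<Sum>v\<in>nodes_near n p. node_dist v powr s) \<le> C * r powr s + \<epsilon>" using \<epsilon> by simp
        moreover have "dist p (point c b) \<le> 4 / real m ^ n"
          if "c \<in> digit_seqs k" "b \<in> digit_seqs l" "f (point c b) \<in> U" for c b
        proof -
          have "dist p (point c b) \<le> 2 * R" using that by (intro inR) (auto simp: E_def)
          also have "\<dots> \<le> 4 / real m ^ n" using n2 by simp
          finally show ?thesis .
        qed
        ultimately show ?thesis
          using nodes_near_subset[of n p] card_nodes_near[of n p]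
          by (intro exI[of _ "nodes_near n p"]) (auto intro!: hit)
      qed
    qed
  qed
  show thesis using C0 main by (rule that)
qed

lemma hausdorff_sum_lower_bound:
  assumes s: "0 < s" "s < exponent"
  obtains c\<^sub>3 where "0 < c\<^sub>3" "\<And>U \<delta>. U \<in> delta_covers Y \<delta> \<Longrightarrow>
    ennreal c\<^sub>3 \<le> (\<Sum>i. ennreal (enn2real (ediam Y (U i)) powr s))"
proof -
  obtain c\<^sub>2 where c\<^sub>2: "0 < c\<^sub>2" "\<And>A. finite A \<Longrightarrow> A \<subseteq> nodes \<Longrightarrow> covering k l A \<Longrightarrow>
    c\<^sub>2 \<le> (\<Sum>v\<in>A. node_dist v powr s)"
    by (rule covering_sum_lower_bound[OF s]) blast
  obtain C where C: "0 < C"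
    "\<And>U \<epsilon> r. (\<And>x y. x \<in> U \<Longrightarrow> y \<in> U \<Longrightarrow> mdist Y x y \<le> r) \<Longrightarrow> 0 \<le> r \<Longrightarrow> 0 < \<epsilon> \<Longrightarrow>
      \<exists>F \<subseteq> nodes. finite F \<and> (\<Sum>v\<in>F. node_dist v powr s) \<le> C * r powr s + \<epsilon> \<and>
        (\<forall>c\<in>digit_seqs k. \<forall>b\<in>digit_seqs l. f (point c b) \<in> U \<longrightarrow>
          (\<exists>(xs, ys)\<in>F. prefix c (length xs) = xs \<and> prefix b (length ys) = ys))"
    by (rule cover_set_by_nodes[OF s(1)]) blast
  have "ennreal (c\<^sub>2 / (2 * C)) \<le> (\<Sum>i. ennreal (enn2real (ediam Y (U i)) powr s))"
    if U: "U \<in> delta_covers Y \<delta>" for U \<delta>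
  proof -
    define r where "r = (\<lambda>i. enn2real (ediam Y (U i)))"
    define \<epsilon> where "\<epsilon> = (\<lambda>i::nat. c\<^sub>2 / 2 * (1 / 2) ^ Suc i)"
    have dist_r: "mdist Y x y \<le> r i" if "x \<in> U i" "y \<in> U i" for x y i
    proof -
      have "ennreal (mdist Y x y) \<le> ediam Y (U i)"
        unfolding ediam_def using that by (intro SUP_upper2[of x] SUP_upper2[of y]) auto
      moreover have "ediam Y (U i) \<le> ennreal \<delta>" using U by (simp add: delta_covers_def)
      then have "ediam Y (U i) < top" by (rule le_less_trans) simp
      ultimately show ?thesis
        unfolding r_def using enn2real_mono[of "ennreal (mdist Y x y)" "ediam Y (U i)"] by simp
    qed
    let ?good = "\<lambda>i F. F \<subseteq> nodes \<and> finite F \<and>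
        (\<Sum>v\<in>F. node_dist v powr s) \<le> C * r i powr s + \<epsilon> i \<and>
        (\<forall>c\<in>digit_seqs k. \<forall>b\<in>digit_seqs l. f (point c b) \<in> U i \<longrightarrow>
          (\<exists>(xs, ys)\<in>F. prefix c (length xs) = xs \<and> prefix b (length ys) = ys))"
    have "\<exists>F. \<forall>i. ?good i (F i)"
    proof (intro choice allI)
      show "\<exists>F. ?good i F" for i
        using c\<^sub>2(1) by (intro C(2) dist_r) (auto simp: r_def \<epsilon>_def)
    qed
    then obtain F where good: "\<And>i. ?good i (F i)" by blast
    have F: "\<And>i. F i \<subseteq> nodes" "\<And>i. finite (F i)"
      "\<And>i. (\<Sum>v\<in>F i. node_dist v powr s) \<le> C * r i powr s + \<epsilon> i"
      "\<And>i c b. c \<in> digit_seqs k \<Longrightarrow> b \<in> digit_seqs l \<Longrightarrow> f (point c b) \<in> U i \<Longrightarrow>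
          \<exists>(xs, ys)\<in>F i. prefix c (length xs) = xs \<and> prefix b (length ys) = ys"
      using good by simp_all
    have "covering k l (\<Union>i. F i)"
      unfolding covering_def
    proof (intro ballI)
      fix c b assume cb: "c \<in> digit_seqs k" "b \<in> digit_seqs l"
      have "f (point c b) \<in> (\<Union>i. U i)"
        using U f_in[OF point_in_bm_set[OF cb]] by (auto simp: delta_covers_def)
      then show "\<exists>(xs, ys)\<in>(\<Union>i. F i). prefix c (length xs) = xs \<and> prefix b (length ys) = ys"
        using F(4)[OF cb] by blast
    qed
    then obtain G where G: "G \<subseteq> (\<Union>i. F i)" "finite G" "covering k l G"
      by (rule covering_finite_subset)
    have "\<forall>v\<in>G. \<exists>i. v \<in> F i" using G(1) by blast
    then obtain g where g: "\<And>v. v \<in> G \<Longrightarrow> v \<in> F (g v)" by metis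
    obtain N where "g ` G \<subseteq> {..<N}" using G(2) finite_nat_bounded by blast
    then have G_sub: "G \<subseteq> (\<Union>i<N. F i)" using g by fast
    have "c\<^sub>2 \<le> (\<Sum>v\<in>G. node_dist v powr s)"
      using G F(1) by (intro c\<^sub>2(2)) auto
    also have "\<dots> \<le> (\<Sum>v\<in>(\<Union>i<N. F i). node_dist v powr s)"
      using G_sub F(2) by (intro sum_mono2) auto
    also have "\<dots> \<le> (\<Sum>i<N. \<Sum>v\<in>F i. node_dist v powr s)"
      by (intro sum_UN_le F(2)) auto
    also have "\<dots> \<le> (\<Sum>i<N. C * r i powr s + \<epsilon> i)"
      by (intro sum_mono F(3))
    also have "\<dots> = C * (\<Sum>i<N. r i powr s) + (\<Sum>i<N. \<epsilon> i)"
      by (simp add: sum.distrib sum_distrib_left)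
    also have "(\<Sum>i<N. \<epsilon> i) \<le> c\<^sub>2 / 2"
    proof -
      have "(\<Sum>i<N. (1 / 2 :: real) ^ Suc i) = 1 - (1 / 2) ^ N"
        by (induction N) auto
      then have "(\<Sum>i<N. \<epsilon> i) = c\<^sub>2 / 2 * (1 - (1 / 2) ^ N)"
        unfolding \<epsilon>_def by (simp only: sum_distrib_left[symmetric])
      also have "\<dots> \<le> c\<^sub>2 / 2 * 1" using c\<^sub>2(1) by (intro mult_left_mono) auto
      finally show ?thesis by simp
    qed
    finally have "c\<^sub>2 / (2 * C) \<le> (\<Sum>i<N. r i powr s)"
      using C(1) by (simp add: pos_divide_le_eq field_simps)
    then have "ennreal (c\<^sub>2 / (2 * C)) \<le> ennreal (\<Sum>i<N. r i powr s)"
      by (rule ennreal_leI)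
    also have "\<dots> = (\<Sum>i<N. ennreal (r i powr s))"
      by (simp add: sum_ennreal)
    also have "\<dots> \<le> (\<Sum>i. ennreal (r i powr s))"
      by (intro sum_le_suminf) auto
    finally show ?thesis by (simp add: r_def)
  qed
  moreover have "0 < c\<^sub>2 / (2 * C)" using c\<^sub>2 C by simp
  ultimately show thesis using that by blast
qed

lemma hausdorff_dim_ge_exponent: "ennreal exponent \<le> hausdorff_dim Y"
  unfolding hausdorff_dim_def
proof (rule Inf_greatest)
  fix x assume "x \<in> {ennreal s |s. 0 < s \<and> hausdorff_measure Y s = 0}"
  then obtain s where s: "x = ennreal s" "0 < s" "hausdorff_measure Y s = 0" by auto
  have "\<not> s < exponent"
  proof
    assume "s < exponent"
    obtain c\<^sub>3 where c\<^sub>3: "0 < c\<^sub>3" "\<And>U \<delta>. U \<in> delta_covers Y \<delta> \<Longrightarrow>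
        ennreal c\<^sub>3 \<le> (\<Sum>i. ennreal (enn2real (ediam Y (U i)) powr s))"
      by (rule hausdorff_sum_lower_bound[OF s(2) \<open>s < exponent\<close>]) blast
    have "ennreal c\<^sub>3 \<le> hausdorff_premeasure Y s 1"
      unfolding hausdorff_premeasure_def by (intro INF_greatest c\<^sub>3(2))
    also have "\<dots> \<le> hausdorff_measure Y s"
      unfolding hausdorff_measure_def by (intro SUP_upper) auto
    finally show False using s(3) c\<^sub>3(1) by (simp add: ennreal_eq_0_iff)
  qed
  then show "ennreal exponent \<le> x" using s by (simp add: ennreal_leI)
qed

end

section \<open>Minimality for conformal dimension\<close>

lemma ediam_empty [simp]: "ediam X {} = 0"
  by (simp add: ediam_def bot_ennreal)

lemma ediam_le:
  assumes "\<And>x y. x \<in> U \<Longrightarrow> y \<in> U \<Longrightarrow> mdist X x y \<le> r"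
  shows "ediam X U \<le> ennreal r"
  unfolding ediam_def using assms by (intro SUP_least ennreal_leI)

lemma hausdorff_premeasure_le_finite_cover:
  assumes V: "finite V" and cover: "mspace X \<subseteq> (\<Union>v\<in>V. S v)"
    and diam: "\<And>v x y. v \<in> V \<Longrightarrow> x \<in> S v \<inter> mspace X \<Longrightarrow> y \<in> S v \<inter> mspace X \<Longrightarrow> mdist X x y \<le> r"
    and r: "0 \<le> r" "r \<le> \<delta>" and s: "0 < s"
  shows "hausdorff_premeasure X s \<delta> \<le> ennreal (real (card V) * r powr s)"
proof -
  obtain h where h: "bij_betw h {0..<card V} V"
    using ex_bij_betw_nat_finite[OF V] by blast
  define U where "U = (\<lambda>i. if i < card V then S (h i) \<inter> mspace X else {})"
  have hV: "h i \<in> V" if "i < card V" for i using bij_betwE[OF h] that by simp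
  have U_diam: "ediam X (U i) \<le> ennreal r" for i
    unfolding U_def using diam hV by (auto intro!: ediam_le)
  have "U \<in> delta_covers X \<delta>"
  proof -
    have "ediam X (U i) \<le> ennreal \<delta>" for i
      using U_diam r(2) by (meson ennreal_leI order_trans)
    moreover have "mspace X \<subseteq> (\<Union>i. U i)"
    proof
      fix x assume x: "x \<in> mspace X"
      then obtain v where v: "v \<in> V" "x \<in> S v" using cover by auto
      have "v \<in> h ` {0..<card V}" using bij_betw_imp_surj_on[OF h] v by simp
      then obtain i where "i < card V" "h i = v" by auto
      then show "x \<in> (\<Union>i. U i)" using x v by (auto simp: U_def)
    qed
    ultimately show ?thesis by (auto simp: delta_covers_def U_def)
  qed
  then have "hausdorff_premeasure X s \<delta> \<le> (\<Sum>i. ennreal (enn2real (ediam X (U i)) powr s))"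
    unfolding hausdorff_premeasure_def by (rule INF_lower)
  also have "\<dots> = (\<Sum>i<card V. ennreal (enn2real (ediam X (U i)) powr s))"
    by (rule suminf_finite) (auto simp: U_def)
  also have "\<dots> \<le> (\<Sum>i<card V. ennreal (r powr s))"
  proof (intro sum_mono ennreal_leI powr_mono2)
    show "enn2real (ediam X (U i)) \<le> r" for i
      using enn2real_mono[OF U_diam[of i]] r by simp
  qed (use s in auto)
  also have "\<dots> = ennreal (real (card V) * r powr s)"
    by (simp add: ennreal_mult ennreal_of_nat_eq_real_of_nat)
  finally show ?thesis .
qed

lemma quasisymmetric_id: "quasisymmetric X X id"
proof -
  have "homeomorphism {0..} {0..} (\<lambda>x::real. x) (\<lambda>x. x)"
    by (rule homeomorphism_ident)
  then show ?thesis
    unfolding quasisymmetric_def by (auto intro!: exI[of _ "\<lambda>x::real. x"])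
qed

context bm_uniform
begin

lemma mspace_bm_space [simp]: "mspace (bm_space m l D) = bm_set m l D"
  and mdist_bm_space [simp]: "mdist (bm_space m l D) = dist"
  by (simp_all add: bm_space_def)

text \<open>
  At level \<open>n\<close> there are at most \<open>l * (k * m) ^ n\<close> approximate squares, of diameter at most \<open>2/m\<^sup>n\<close>.
\<close>

lemma hausdorff_measure_bm_space_eq_0:
  assumes s: "exponent < s"
  shows "hausdorff_measure (bm_space m l D) s = 0"
proof -
  let ?X = "bm_space m l D"
  have s0: "0 < s" using s exponent_ge_1 by simp
  define x where "x = real m powr (exponent - s)"
  have x: "0 < x" "x < 1"
    using s m_ge_2 powr_less_mono[of "exponent - s" 0 "real m"] by (auto simp: x_def)
  define a where "a = (\<lambda>n. real l * 2 powr s * x ^ n)"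
  have "hausdorff_premeasure ?X s \<delta> = 0" if \<delta>: "0 < \<delta>" for \<delta>
  proof -
    obtain n0 where n0: "(1 / real m) ^ n0 < \<delta> / 2"
      using real_arch_pow_inv[of "\<delta> / 2" "1 / real m"] \<delta> m_ge_2 by auto
    have bound: "hausdorff_premeasure ?X s \<delta> \<le> ennreal (a n)" if n: "max 1 n0 \<le> n" for n
    proof -
      let ?V = "words k n \<times> words l (height n)" and ?r = "2 / real m ^ n"
      have "2 / real m ^ n \<le> 2 / real m ^ n0"
        using m_ge_2 n by (intro divide_left_mono power_increasing) auto
      then have r\<delta>: "?r \<le> \<delta>" using n0 by (simp add: power_one_over)
      have card: "real (card ?V) \<le> real k ^ n * (real l * real m ^ n)"
        using height_le[of n]
        by (simp add: card_cartesian_product card_words flip: of_nat_power of_nat_mult)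
      have "hausdorff_premeasure ?X s \<delta> \<le> ennreal (real (card ?V) * ?r powr s)"
      proof (rule hausdorff_premeasure_le_finite_cover[where S = "\<lambda>(cs, bs). approx_square n cs bs"])
        show "mspace ?X \<subseteq> (\<Union>v\<in>?V. case v of (cs, bs) \<Rightarrow> approx_square n cs bs)"
          using bm_set_cover n by fastforce
        show "mdist ?X p q \<le> ?r" if "v \<in> ?V"
          "p \<in> (case v of (cs, bs) \<Rightarrow> approx_square n cs bs) \<inter> mspace ?X"
          "q \<in> (case v of (cs, bs) \<Rightarrow> approx_square n cs bs) \<inter> mspace ?X" for v p q
          using that by (auto intro!: dist_approx_square split: prod.splits)
      qed (use r\<delta> s0 in auto)
      also have "\<dots> \<le> ennreal (real k ^ n * (real l * real m ^ n) * ?r powr s)"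
        using card by (intro ennreal_leI mult_right_mono) auto
      also have "real k ^ n * (real l * real m ^ n) * ?r powr s = a n"
      proof -
        have mn: "real m ^ n = real m powr real n" using m_pos by (simp add: powr_realpow)
        have kn: "real k ^ n = real m powr (real n * (exponent - 1))"
          using m_pos by (simp add: powr_power mult.commute flip: m_powr_exponent)
        have r: "?r powr s = 2 powr s * real m powr (- (real n * s))"
          unfolding mn powr_divide powr_powr powr_minus by (simp add: divide_inverse)
        have xn: "x ^ n = real m powr (real n * (exponent - s))"
          unfolding x_def using m_pos by (simp add: powr_power mult.commute)
        have "real n * (exponent - s) = real n * (exponent - 1) + real n + - (real n * s)"
          by (simp add: algebra_simps)
        then have "x ^ n = real m powr (real n * (exponent - 1)) * real m powr real n * real m powr (- (real n * s))"
          unfolding xn by (simp only: powr_add)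
        then show ?thesis unfolding a_def kn r by (simp add: mn)
      qed
      finally show ?thesis .
    qed
    have "a \<longlonglongrightarrow> real l * 2 powr s * 0"
      unfolding a_def by (intro tendsto_mult_left LIMSEQ_power_zero) (use x in auto)
    then have "(\<lambda>n. ennreal (a n)) \<longlonglongrightarrow> ennreal 0"
      by (intro tendsto_ennrealI) simp
    moreover have "\<forall>\<^sub>F n in sequentially. hausdorff_premeasure ?X s \<delta> \<le> ennreal (a n)"
      using bound unfolding eventually_sequentially by blast
    ultimately have "hausdorff_premeasure ?X s \<delta> \<le> ennreal 0"
      by (rule tendsto_lowerbound) simp
    then show ?thesis by simp
  qed
  then have "hausdorff_measure ?X s = (SUP \<delta>\<in>{0::real<..}. 0)"
    unfolding hausdorff_measure_def by (intro SUP_cong) auto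
  then show ?thesis by (simp add: bot_ennreal)
qed

lemma hausdorff_dim_bm_space_le: "hausdorff_dim (bm_space m l D) \<le> ennreal exponent"
proof (rule ennreal_le_epsilon)
  fix e :: real assume e: "0 < e"
  have "hausdorff_dim (bm_space m l D) \<le> ennreal (exponent + e)"
    unfolding hausdorff_dim_def using e exponent_ge_1 hausdorff_measure_bm_space_eq_0[of "exponent + e"]
    by (intro Inf_lower) (auto intro!: exI[of _ "exponent + e"])
  then show "hausdorff_dim (bm_space m l D) \<le> ennreal exponent + ennreal e"
    using e exponent_ge_1 by (simp add: ennreal_plus)
qed

text \<open>
  The control function \<open>\<eta>\<close> is a homeomorphism of the half line, hence increasing with \<open>\<eta> 0 = 0\<close>.
\<close>

lemma hausdorff_dim_quasisymmetric_image_ge: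
  assumes qs: "quasisymmetric (bm_space m l D) Y f"
  shows "ennreal exponent \<le> hausdorff_dim Y"
proof -
  let ?K = "bm_set m l D"
  have hom: "homeomorphic_map (mtopology_of (bm_space m l D)) (mtopology_of Y) f"
    using qs by (simp add: quasisymmetric_def)
  have inj: "inj_on f ?K" and im: "f ` ?K = mspace Y"
    using homeomorphic_imp_injective_map[OF hom] homeomorphic_imp_surjective_map[OF hom] by simp_all
  obtain \<eta> \<theta> :: "real \<Rightarrow> real" where \<eta>: "homeomorphism {0..} {0..} \<eta> \<theta>"
    and ineq: "\<And>x y z. x \<in> ?K \<Longrightarrow> y \<in> ?K \<Longrightarrow> z \<in> ?K \<Longrightarrow> x \<noteq> z \<Longrightarrow>
      mdist Y (f x) (f y) / mdist Y (f x) (f z) \<le> \<eta> (dist x y / dist x z)"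
    using qs by (auto simp: quasisymmetric_def)
  have cont: "continuous_on {0..} \<eta>" and onto: "\<eta> ` {0..} = {0..}" and \<theta>: "\<And>x. 0 \<le> x \<Longrightarrow> \<theta> (\<eta> x) = x"
    using \<eta> by (auto simp: homeomorphism_def)
  have "inj_on \<eta> {0..}" using \<theta> by (metis atLeast_iff inj_onI)
  then have "strict_mono_on {0..} \<eta> \<or> strict_antimono_on {0..} \<eta>"
    using injective_eq_monotone_map[OF _ cont] by (simp add: is_interval_ci)
  moreover have "\<not> strict_antimono_on {0..} \<eta>"
  proof
    assume anti: "strict_antimono_on {0..} \<eta>"
    have "0 \<le> \<eta> 0" using onto by force
    then have "\<eta> 0 + 1 \<in> \<eta> ` {0..}" unfolding onto by simp
    then obtain x where "0 \<le> x" "\<eta> x = \<eta> 0 + 1" by force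
    then show False
      using monotone_onD[OF anti, of 0 x] by (cases "x = 0") auto
  qed
  ultimately have mono: "strict_mono_on {0..} \<eta>" by blast
  have le: "\<eta> s \<le> \<eta> t" if "0 \<le> s" "s \<le> t" for s t
    using that monotone_onD[OF mono, of s t] by (cases "s = t") auto
  have zero: "\<eta> 0 = 0"
  proof -
    have "0 \<in> \<eta> ` {0..}" unfolding onto by simp
    then obtain x where "0 \<le> x" "\<eta> x = 0" by force
    moreover have "0 \<le> \<eta> 0" using onto by force
    ultimately show ?thesis using le[of 0 x] by simp
  qed
  interpret bm_qs m l k D Y f \<eta>
  proof
    show "f x \<in> mspace Y" if "x \<in> ?K" for x using im that by blast
    show "inj_on f ?K" by (rule inj)
    show "\<eta> s \<le> \<eta> t" if "0 \<le> s" "s \<le> t" for s t using that by (rule le)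
    show "\<eta> 0 = 0" by (rule zero)
    show "\<exists>\<delta>>0. \<eta> \<delta> \<le> \<epsilon>" if "0 < \<epsilon>" for \<epsilon>
    proof -
      have "\<epsilon> \<in> \<eta> ` {0..}" unfolding onto using that by simp
      then obtain x where "0 \<le> x" "\<eta> x = \<epsilon>" by force
      then show ?thesis using that zero by (intro exI[of _ x]) (cases "x = 0", auto)
    qed
    show "mdist Y (f x) (f y) \<le> \<eta> (dist x y / dist x z) * mdist Y (f x) (f z)"
      if K: "x \<in> ?K" "y \<in> ?K" "z \<in> ?K" and "x \<noteq> z" for x y z
    proof -
      have "f x \<noteq> f z" using inj K \<open>x \<noteq> z\<close> by (simp add: inj_on_eq_iff)
      moreover have "f x \<in> mspace Y" "f z \<in> mspace Y" using im K by blast+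
      ultimately have "mdist Y (f x) (f z) \<noteq> 0" by simp
      then have "0 < mdist Y (f x) (f z)" using mdist_nonneg[of Y "f x" "f z"] by linarith
      then show ?thesis using ineq[OF K \<open>x \<noteq> z\<close>] by (simp only: pos_divide_le_eq)
    qed
  qed
  show ?thesis by (rule hausdorff_dim_ge_exponent)
qed

end

theorem theorem1p2:
  fixes l m k :: nat and D :: "nat \<Rightarrow> (nat \<times> nat) set"
  assumes "1 < l" and "l < m" and "1 \<le> k" and "k \<le> m"
    and "bm_patterns m l D" and "uniform_fibers l k D"
  shows "minimal_for_conformal_dim (bm_space m l D) \<and>
    conformal_dim (bm_space m l D) = hausdorff_dim (bm_space m l D) \<and>
    hausdorff_dim (bm_space m l D) = ennreal (1 + log (real m) (real k))"
proof -
  interpret bm_uniform m l k D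
    using assms by unfold_locales
  let ?X = "bm_space m l D"
  have "ennreal exponent \<le> conformal_dim ?X"
    unfolding conformal_dim_def by (rule Inf_greatest) (auto intro: hausdorff_dim_quasisymmetric_image_ge)
  moreover have "conformal_dim ?X \<le> hausdorff_dim ?X"
    by (rule conformal_dim_le[OF quasisymmetric_id])
  moreover have "hausdorff_dim ?X \<le> ennreal exponent"
    by (rule hausdorff_dim_bm_space_le)
  ultimately have "conformal_dim ?X = hausdorff_dim ?X" "hausdorff_dim ?X = ennreal exponent"
    by order+
  then show ?thesis
    by (simp add: minimal_for_conformal_dim_def exponent_def)
qed

end
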